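(* Let $n$ be a positive integer, let $R$ be an associative unital ring with at least two elements, and let $G$ be a $\mathrm{PD}^n_R$ group (a Poincaré duality group of dimension $n$ over $R$). Suppose that additionally one of the following holds: (1) $R$ is a $*$-ring and $G$ is orientable; (2) $R$ is commutative. If $G$ is not amenable, then $G$ satisfies a linear $R$-homological isoperimetric inequality in dimension $n-1$.
   Context: A group $G$ is a Poincaré duality group of dimension $n\geq 1$ over $R$ (a $\mathrm{PD}^n_R$ group) if $G$ is of type $\mathrm{FP}$ over $R$ (the trivial $RG$-module $R$ has a finite-length resolution by finitely generated projective $RG$-modules) and $H^k(G;RG)\cong R$ as an $R$-module if $k=n$, while $H^k(G;RG)=0$ for $k\neq n$. It is oriented (or orientable) if $H^n(G;RG)$ is the trivial $RG$-module $R$. $G$ is not assumed to be finitely presented. A $*$-ring is a ring $R$ equipped with an involutive antiautomorphism $r\mapsto r^*$. Then $RG$ is also a $*$-ring via $\big(\sum_g r_g g\big)^*=\sum_g r_g^* g^{-1}$. Modules are left modules; the natural right $RG$-module $H^n(G;RG)$ is regarded as a left module via $x\cdot c = c\,x^*$ (with $r^*=r$ when $R$ is commutative). For $k\ge 0$, a projective resolution $C_\bullet=(C_j,\partial_j)$ of the trivial $RG$-module $R$ is $k$-admissible if $C_k$ and $C_{k+1}$ are finitely generated free $RG$-modules equipped with (fixed) free bases; elements of $C_k$ and $C_{k+1}$ are thus treated as vectors over $RG$. For $x\in RG$, $|x|$ denotes the cardinality of the support of $x$; for a finite matrix (in particular a vector) $A=(a_{ij})$ over $RG$, $|A|=\sum_{i,j}|a_{ij}|$.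 A $k$-admissible resolution $C_\bullet$ satisfies a linear isoperimetric inequality in dimension $k$ if there exists $\kappa\geq 0$ such that for every $k$-boundary $\gamma\in C_k$ (element of the image of $\partial_{k+1}$) there exists $d\in C_{k+1}$ with $\partial d=\gamma$ and $|d|\leq\kappa|\gamma|$. A group $G$ satisfies a linear $R$-homological isoperimetric inequality in dimension $k$ if it admits a $k$-admissible resolution of the trivial $RG$-module $R$ which satisfies a linear isoperimetric inequality in dimension $k$. *)

theory Defs
  imports Complex_Main "HOL-Library.Poly_Mapping"
begin

section \<open>Group rings\<close>

text \<open>
  The group \<open>G\<close> is a type of class \<^class>\<open>group_add\<close> (written additively, not assumed
  commutative) and the coefficient ring \<open>R\<close> is a type of class \<^class>\<open>ring_1\<close> (associative, unital,
  \<open>0 \<noteq> 1\<close>).  With its convolution product, the type of finitely supported functions from \<open>G\<close>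
  to \<open>R\<close> is then the group ring \<open>RG\<close>: the element \<open>r g\<close> is \<open>Poly_Mapping.single g r\<close>.
\<close>

type_synonym ('g, 'r) group_ring = "'g \<Rightarrow>\<^sub>0 'r"

definition augmentation :: "('g::group_add, 'r::ring_1) group_ring \<Rightarrow> 'r" where
  "augmentation x = (\<Sum>g\<in>Poly_Mapping.keys x. Poly_Mapping.lookup x g)"

text \<open>The trivial left \<open>RG\<close>-module \<open>R\<close>.\<close>

definition trivial_scale :: "('g::group_add, 'r::ring_1) group_ring \<Rightarrow> 'r \<Rightarrow> 'r" where
  "trivial_scale x c = augmentation x * c"

definition support_size :: "('g::group_add, 'r::ring_1) group_ring \<Rightarrow> nat" where
  "support_size x = card (Poly_Mapping.keys x)"

definition star_ring :: "('r::ring_1 \<Rightarrow> 'r) \<Rightarrow> bool" where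
  "star_ring star \<longleftrightarrow>
     (\<forall>a b. star (a + b) = star a + star b) \<and>
     (\<forall>a b. star (a * b) = star b * star a) \<and>
     (\<forall>a. star (star a) = a)"

definition group_ring_star ::
    "('r::ring_1 \<Rightarrow> 'r) \<Rightarrow> ('g::group_add, 'r) group_ring \<Rightarrow> ('g, 'r) group_ring" where
  "group_ring_star star x =
     (\<Sum>g\<in>Poly_Mapping.keys x. Poly_Mapping.single (- g) (star (Poly_Mapping.lookup x g)))"


section \<open>Projective modules over the group ring\<close>

text \<open>
  HOL cannot quantify existentially over all modules, so the left modules in a resolution are
  submodules of one free left \<open>RG\<close>-module, the one with basis \<open>nat \<times> RG\<close>.  Its rank \<open>\<kappa>\<close> is the
  maximum of \<open>|RG|\<close> and \<open>\<aleph>\<^sub>0\<close>, so every projective module with at most \<open>\<kappa>\<close> generators (in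
  particular every finitely generated one) is isomorphic to such a submodule.  Every module
  of cardinality at most \<open>\<kappa>\<close> has a projective resolution by modules of this kind.
\<close>

type_synonym ('g, 'r) ambient = "(nat \<times> ('g, 'r) group_ring) \<Rightarrow>\<^sub>0 ('g, 'r) group_ring"

definition scale ::
    "('g::group_add, 'r::ring_1) group_ring \<Rightarrow> ('g, 'r) ambient \<Rightarrow> ('g, 'r) ambient" where
  "scale a x = Poly_Mapping.map ((*) a) x"

lemma lookup_scale: "Poly_Mapping.lookup (scale a x) i = a * Poly_Mapping.lookup x i"
  by (auto simp: scale_def Poly_Mapping.map.rep_eq when_def)

definition submodule :: "('g::group_add, 'r::ring_1) ambient set \<Rightarrow> bool" where
  "submodule M \<longleftrightarrow>
     0 \<in> M \<and> (\<forall>x\<in>M. \<forall>y\<in>M. x + y \<in> M) \<and> (\<forall>a. \<forall>x\<in>M. scale a x \<in> M)"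

text \<open>Homomorphisms of modules with scalar multiplications \<open>s\<close>, \<open>s'\<close> and carriers \<open>M\<close>, \<open>N\<close>; the
  values of \<open>f\<close> outside \<open>M\<close> are irrelevant.\<close>

definition module_hom_on ::
    "('a \<Rightarrow> 'm \<Rightarrow> 'm) \<Rightarrow> ('a \<Rightarrow> 'n \<Rightarrow> 'n) \<Rightarrow> 'm::ab_group_add set \<Rightarrow> 'n::ab_group_add set \<Rightarrow>
     ('m \<Rightarrow> 'n) \<Rightarrow> bool" where
  "module_hom_on s s' M N f \<longleftrightarrow>
     (\<forall>x\<in>M. f x \<in> N) \<and>
     (\<forall>x\<in>M. \<forall>y\<in>M. f (x + y) = f x + f y) \<and>
     (\<forall>a. \<forall>x\<in>M. f (s a x) = s' a (f x))"

text \<open>A module is projective if it is, up to isomorphism, a direct summand of a free module, i.e.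
  a retract of a free module.  The ambient free module is large enough to map onto any of its
  submodules, so no other free module has to be considered.\<close>

definition projective_module :: "('g::group_add, 'r::ring_1) ambient set \<Rightarrow> bool" where
  "projective_module M \<longleftrightarrow>
     submodule M \<and>
     (\<exists>i p. module_hom_on scale scale M UNIV i \<and> module_hom_on scale scale UNIV M p \<and>
            (\<forall>x\<in>M. p (i x) = x))"

definition finitely_generated :: "('g::group_add, 'r::ring_1) ambient set \<Rightarrow> bool" where
  "finitely_generated M \<longleftrightarrow>
     (\<exists>S. finite S \<and> S \<subseteq> M \<and> (\<forall>x\<in>M. \<exists>c. x = (\<Sum>b\<in>S. scale (c b) b)))"

definition is_coords ::
    "('g::group_add, 'r::ring_1) ambient set \<Rightarrow> ('g, 'r) ambient \<Rightarrow>
     (('g, 'r) ambient \<Rightarrow> ('g, 'r) group_ring) \<Rightarrow> bool" where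
  "is_coords B x c \<longleftrightarrow> (\<forall>b. b \<notin> B \<longrightarrow> c b = 0) \<and> x = (\<Sum>b\<in>B. scale (c b) b)"

definition finite_free_basis ::
    "('g::group_add, 'r::ring_1) ambient set \<Rightarrow> ('g, 'r) ambient set \<Rightarrow> bool" where
  "finite_free_basis M B \<longleftrightarrow> finite B \<and> B \<subseteq> M \<and> (\<forall>x\<in>M. \<exists>!c. is_coords B x c)"

definition vector_size ::
    "('g::group_add, 'r::ring_1) ambient set \<Rightarrow> ('g, 'r) ambient \<Rightarrow> nat" where
  "vector_size B x = (\<Sum>b\<in>B. support_size ((THE c. is_coords B x c) b))"


section \<open>Resolutions and group cohomology\<close>

text \<open>The boundary map \<open>bd (Suc j)\<close> maps \<open>C (Suc j)\<close> to \<open>C j\<close>; \<open>bd 0\<close> is not used.\<close>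

definition projective_resolution ::
    "(nat \<Rightarrow> ('g::group_add, 'r::ring_1) ambient set) \<Rightarrow>
     (nat \<Rightarrow> ('g, 'r) ambient \<Rightarrow> ('g, 'r) ambient) \<Rightarrow> (('g, 'r) ambient \<Rightarrow> 'r) \<Rightarrow> bool" where
  "projective_resolution C bd \<epsilon> \<longleftrightarrow>
     (\<forall>j. projective_module (C j)) \<and>
     (\<forall>j. module_hom_on scale scale (C (Suc j)) (C j) (bd (Suc j))) \<and>
     module_hom_on scale trivial_scale (C 0) UNIV \<epsilon> \<and>
     \<epsilon> ` C 0 = UNIV \<and>
     {x \<in> C 0. \<epsilon> x = 0} = bd 1 ` C 1 \<and>
     (\<forall>j. {x \<in> C (Suc j). bd (Suc j) x = 0} = bd (Suc (Suc j)) ` C (Suc (Suc j)))"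

definition type_FP :: "'g::group_add itself \<Rightarrow> 'r::ring_1 itself \<Rightarrow> bool" where
  "type_FP _ _ \<longleftrightarrow>
     (\<exists>(C :: nat \<Rightarrow> ('g, 'r) ambient set) bd \<epsilon>. projective_resolution C bd \<epsilon> \<and>
        (\<forall>j. finitely_generated (C j)) \<and> (\<exists>N. \<forall>j>N. C j = {0}))"

text \<open>\<open>Hom\<^sub>R\<^sub>G(C\<^sub>k, RG)\<close>; homomorphisms are extended by \<open>0\<close> so that they are determined by their
  values on \<open>C k\<close>.  It is a right \<open>RG\<close>-module by \<open>(f x)(c) = f c * x\<close>.\<close>

definition cochains ::
    "(nat \<Rightarrow> ('g::group_add, 'r::ring_1) ambient set) \<Rightarrow> nat \<Rightarrow>
     (('g, 'r) ambient \<Rightarrow> ('g, 'r) group_ring) set" where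
  "cochains C k = {f. module_hom_on scale (*) (C k) UNIV f \<and> (\<forall>x. x \<notin> C k \<longrightarrow> f x = 0)}"

definition cocycles ::
    "(nat \<Rightarrow> ('g::group_add, 'r::ring_1) ambient set) \<Rightarrow>
     (nat \<Rightarrow> ('g, 'r) ambient \<Rightarrow> ('g, 'r) ambient) \<Rightarrow> nat \<Rightarrow>
     (('g, 'r) ambient \<Rightarrow> ('g, 'r) group_ring) set" where
  "cocycles C bd k = {f \<in> cochains C k. \<forall>x\<in>C (Suc k). f (bd (Suc k) x) = 0}"

primrec coboundaries ::
    "(nat \<Rightarrow> ('g::group_add, 'r::ring_1) ambient set) \<Rightarrow>
     (nat \<Rightarrow> ('g, 'r) ambient \<Rightarrow> ('g, 'r) ambient) \<Rightarrow> nat \<Rightarrow>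
     (('g, 'r) ambient \<Rightarrow> ('g, 'r) group_ring) set" where
  "coboundaries C bd 0 = {\<lambda>x. 0}"
| "coboundaries C bd (Suc k) =
     {(\<lambda>x. if x \<in> C (Suc k) then f (bd (Suc k) x) else 0) |f. f \<in> cochains C k}"

text \<open>
  \<open>H\<^sup>k(G;RG)\<close> is computed from one projective resolution of the trivial module, fixed once and for
  all for given \<open>G\<close> and \<open>R\<close>; the result does not depend on it up to isomorphism of right
  \<open>RG\<close>-modules.  \<open>H\<^sup>k(G;RG)\<close> is the quotient of \<open>group_cocycles k\<close> by \<open>group_coboundaries k\<close>.
\<close>

definition chosen_resolution ::
    "(nat \<Rightarrow> ('g::group_add, 'r::ring_1) ambient set) \<times>
     (nat \<Rightarrow> ('g, 'r) ambient \<Rightarrow> ('g, 'r) ambient) \<times> (('g, 'r) ambient \<Rightarrow> 'r)" where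
  "chosen_resolution = (SOME (C, bd, \<epsilon>). projective_resolution C bd \<epsilon>)"

definition group_cocycles ::
    "nat \<Rightarrow> (('g::group_add, 'r::ring_1) ambient \<Rightarrow> ('g, 'r) group_ring) set" where
  "group_cocycles k = (case chosen_resolution of (C, bd, \<epsilon>) \<Rightarrow> cocycles C bd k)"

definition group_coboundaries ::
    "nat \<Rightarrow> (('g::group_add, 'r::ring_1) ambient \<Rightarrow> ('g, 'r) group_ring) set" where
  "group_coboundaries k = (case chosen_resolution of (C, bd, \<epsilon>) \<Rightarrow> coboundaries C bd k)"

text \<open>An additive isomorphism of \<open>H\<^sup>k(G;RG)\<close> with \<open>R\<close>, given on representatives.\<close>

definition cohomology_additive_iso ::
    "nat \<Rightarrow> ((('g::group_add, 'r::ring_1) ambient \<Rightarrow> ('g, 'r) group_ring) \<Rightarrow> 'r) \<Rightarrow> bool" where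
  "cohomology_additive_iso k \<phi> \<longleftrightarrow>
     (\<forall>f\<in>group_cocycles k. \<forall>f'\<in>group_cocycles k. \<phi> (\<lambda>x. f x + f' x) = \<phi> f + \<phi> f') \<and>
     \<phi> ` group_cocycles k = UNIV \<and>
     {f \<in> group_cocycles k. \<phi> f = 0} = group_coboundaries k"


section \<open>Poincare duality groups\<close>

text \<open>The isomorphism of \<open>H\<^sup>n(G;RG)\<close> with \<open>R\<close> is one of right \<open>R\<close>-modules, this being the natural
  structure for a ring \<open>R\<close> without involution.  (If \<open>R\<close> has an involution, composing the
  isomorphism with it shows that the condition is the same for the induced left structures.)\<close>

definition PD_group :: "'g::group_add itself \<Rightarrow> 'r::ring_1 itself \<Rightarrow> nat \<Rightarrow> bool" where
  "PD_group G R n \<longleftrightarrow>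
     type_FP G R \<and>
     (\<exists>\<phi> :: (('g, 'r) ambient \<Rightarrow> ('g, 'r) group_ring) \<Rightarrow> 'r.
        cohomology_additive_iso n \<phi> \<and>
        (\<forall>f\<in>group_cocycles n. \<forall>r. \<phi> (\<lambda>x. f x * Poly_Mapping.single 0 r) = \<phi> f * r)) \<and>
     (\<forall>k. k \<noteq> n \<longrightarrow>
        (group_cocycles k :: (('g, 'r) ambient \<Rightarrow> ('g, 'r) group_ring) set) = group_coboundaries k)"

text \<open>\<open>H\<^sup>n(G;RG)\<close>, made into a left module by \<open>x \<cdot> c = c x\<^sup>*\<close>, is the trivial \<open>RG\<close>-module \<open>R\<close>.\<close>

definition orientable :: "'g::group_add itself \<Rightarrow> ('r::ring_1 \<Rightarrow> 'r) \<Rightarrow> nat \<Rightarrow> bool" where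
  "orientable _ star n \<longleftrightarrow>
     (\<exists>\<phi> :: (('g, 'r) ambient \<Rightarrow> ('g, 'r) group_ring) \<Rightarrow> 'r.
        cohomology_additive_iso n \<phi> \<and>
        (\<forall>f\<in>group_cocycles n. \<forall>a.
           \<phi> (\<lambda>x. f x * group_ring_star star a) = trivial_scale a (\<phi> f)))"


section \<open>Amenability and isoperimetric inequalities\<close>

text \<open>Existence of a left-invariant finitely additive probability measure on all subsets.\<close>

definition amenable :: "'g::group_add itself \<Rightarrow> bool" where
  "amenable _ \<longleftrightarrow>
     (\<exists>\<mu> :: 'g set \<Rightarrow> real.
        (\<forall>A. 0 \<le> \<mu> A) \<and> \<mu> UNIV = 1 \<and>
        (\<forall>A B. A \<inter> B = {} \<longrightarrow> \<mu> (A \<union> B) = \<mu> A + \<mu> B) \<and>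
        (\<forall>g A. \<mu> ((+) g ` A) = \<mu> A))"

text \<open>A \<open>k\<close>-admissible resolution, including the fixed bases \<open>B\<close> of \<open>C k\<close> and \<open>B'\<close> of
  \<open>C (Suc k)\<close>.\<close>

definition admissible_resolution ::
    "nat \<Rightarrow> (nat \<Rightarrow> ('g::group_add, 'r::ring_1) ambient set) \<Rightarrow>
     (nat \<Rightarrow> ('g, 'r) ambient \<Rightarrow> ('g, 'r) ambient) \<Rightarrow> (('g, 'r) ambient \<Rightarrow> 'r) \<Rightarrow>
     ('g, 'r) ambient set \<Rightarrow> ('g, 'r) ambient set \<Rightarrow> bool" where
  "admissible_resolution k C bd \<epsilon> B B' \<longleftrightarrow>
     projective_resolution C bd \<epsilon> \<and> finite_free_basis (C k) B \<and> finite_free_basis (C (Suc k)) B'"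

definition linear_isoperimetric ::
    "nat \<Rightarrow> (nat \<Rightarrow> ('g::group_add, 'r::ring_1) ambient set) \<Rightarrow>
     (nat \<Rightarrow> ('g, 'r) ambient \<Rightarrow> ('g, 'r) ambient) \<Rightarrow>
     ('g, 'r) ambient set \<Rightarrow> ('g, 'r) ambient set \<Rightarrow> bool" where
  "linear_isoperimetric k C bd B B' \<longleftrightarrow>
     (\<exists>\<kappa>::real. \<kappa> \<ge> 0 \<and>
        (\<forall>\<gamma> \<in> bd (Suc k) ` C (Suc k). \<exists>d \<in> C (Suc k).
           bd (Suc k) d = \<gamma> \<and> real (vector_size B' d) \<le> \<kappa> * real (vector_size B \<gamma>)))"

definition linear_homological_isoperimetric ::
    "'g::group_add itself \<Rightarrow> 'r::ring_1 itself \<Rightarrow> nat \<Rightarrow> bool" where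
  "linear_homological_isoperimetric _ _ k \<longleftrightarrow>
     (\<exists>(C :: nat \<Rightarrow> ('g, 'r) ambient set) bd \<epsilon> B B'.
        admissible_resolution k C bd \<epsilon> B B' \<and> linear_isoperimetric k C bd B B')"

end

theory Submission
  imports "HOL-Analysis.Function_Topology" Defs
begin

text \<open>
  Choose a resolution \<open>C\<close> with \<open>C (n - 1)\<close> and \<open>C n\<close> free, and a cocycle \<open>z\<close> whose class
  generates \<open>H\<^sup>n(G;RG)\<close> as a right \<open>R\<close>-module.  For \<open>s \<in> G\<close> the cocycle \<open>z s\<close> is, up to a
  coboundary, of the form \<open>z a\<close> with \<open>a \<in> R\<close>, so \<open>z(d) s - z(d) a\<close> is a function of the boundary
  of \<open>d\<close> and has size \<open>O(|\<partial>d|)\<close>.  If \<open>F\<close> is the support of \<open>z(d)\<close>, this bounds \<open>|Fs - F|\<close>, and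
  nonamenability then bounds \<open>|z(d)|\<close> linearly in \<open>|\<partial>d|\<close>.  Since the cohomology vanishes above
  degree \<open>n\<close>, the boundaries in \<open>C n\<close> are a direct summand, so \<open>d\<close> can be replaced by its
  projection \<open>p(d)\<close> to a complement without changing its boundary.  The coordinates of \<open>p\<close> are
  cocycles, hence of the form \<open>z a\<close> plus a coboundary, and so \<open>|p(d)| = O(|\<partial>d|)\<close>.
\<close>

section \<open>Amenability and the Folner condition\<close>

text \<open>The estimate rests on an asymmetry between two right multiplications: \<open>s\<close>
  translates the support \<open>F\<close> of \<open>z(d)\<close> exactly, while a scalar
  \<open>a\<close>, whatever it is, cannot move the support out of \<open>F\<close>. Hence nothing
  cancels on \<open>Fs - F\<close> in \<open>z(d) s - z(d) a\<close>. That this difference is linear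
  in the boundary comes from freeness in degree \<open>n - 1\<close>: a cochain on a finitely
  generated free module increases sizes by at most a constant factor. Bounding \<open>z(d)\<close>
  alone does not bound \<open>d\<close>, because one cochain does not see all coordinates and cycles
  can be added to \<open>d\<close> at will. The projection \<open>p\<close> removes the cycles and
  at the same time makes every coordinate comparable with \<open>z\<close>. Two gaps separate this
  argument from the definitions. Cohomology is computed from an arbitrarily chosen resolution, so
  its generator has to be carried by chain maps to the resolution at hand. And type FP supplies
  projective modules, so complements must be added to make them free, without leaving the single
  ambient module in which all resolutions live.\<close>

lemma amenable_if_Folner:
  assumes "\<And>S \<epsilon>. finite S \<Longrightarrow> \<epsilon> > 0 \<Longrightarrow>
    \<exists>F :: 'g::group_add set. finite F \<and> F \<noteq> {} \<and>
      (\<forall>s\<in>S. real (card ((\<lambda>x. x + s) ` F - F)) \<le> \<epsilon> * real (card F))"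
  shows "amenable TYPE('g)"
proof -
  \<comment> \<open>An invariant mean is found as a limit of counting measures. \<open>X\<close> is
    compact by Tychonoff, and \<open>K (s, m)\<close> is the closed condition of being normalised,
    additive and invariant under \<open>s\<close> up to \<open>1 / (m + 1)\<close>; by compactness
    it suffices to meet finitely many of these at once.\<close>
  define X :: "('g set \<Rightarrow> real) set" where "X = PiE UNIV (\<lambda>_. {0..1})"
  define K :: "'g \<times> nat \<Rightarrow> ('g set \<Rightarrow> real) set" where
    "K = (\<lambda>(s, m). {\<mu>. \<mu> UNIV = 1} \<inter>
       (\<Inter>A. \<Inter>B\<in>{B. A \<inter> B = {}}. {\<mu>. \<mu> (A \<union> B) = \<mu> A + \<mu> B}) \<inter>
       (\<Inter>A. {\<mu>. \<bar>\<mu> ((+) s ` A) - \<mu> A\<bar> \<le> 1 / (real m + 1)}))"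
  have coord: "continuous_on UNIV (\<lambda>\<mu>::'g set \<Rightarrow> real. \<mu> A)" for A
    by (rule continuous_on_product_coordinates)
  have "compact X"
  proof -
    have "compactin (product_topology (\<lambda>_. euclidean) UNIV) X"
      unfolding X_def compactin_PiE by (auto simp: compactin_euclidean_iff)
    then show ?thesis
      by (simp add: euclidean_product_topology compactin_euclidean_iff)
  qed
  have cK: "closed (K i)" for i
    unfolding K_def case_prod_unfold
    by (intro closed_Int closed_INT ballI closed_Collect_eq closed_Collect_le
        continuous_intros coord)
  have fip: "X \<inter> (\<Inter>i\<in>I. K i) \<noteq> {}" if "finite I" for I
  proof -
    \<comment> \<open>The strictest tolerance occurring in \<open>I\<close> serves for all of
      \<open>I\<close>; inserting \<open>0\<close> covers empty \<open>I\<close>.\<close>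
    define M where "M = Max (insert 0 (snd ` I))"
    define S where "S = fst ` I"
    have S: "finite S" "0 < 1 / (real M + 1)"
      using that by (simp_all add: S_def)
    obtain F :: "'g set" where F: "finite F" "F \<noteq> {}" and
      Fol: "\<And>s. s \<in> S \<Longrightarrow> real (card ((\<lambda>x. x + s) ` F - F)) \<le> 1 / (real M + 1) * real (card F)"
      using assms[OF S] by blast
    \<comment> \<open>\<open>F\<close> is almost invariant on the right, but the mean has to be
      invariant on the left; counting the inverses of the elements of \<open>F\<close> exchanges the
      sides.\<close>
    define \<nu> where "\<nu> = (\<lambda>A. {x\<in>F. - x \<in> A})"
    define \<mu> where "\<mu> = (\<lambda>A. real (card (\<nu> A)) / real (card F))"
    have fin: "finite (\<nu> A)" for A
      using F by (simp add: \<nu>_def)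
    have cF: "real (card F) > 0"
      using F by (simp add: card_gt_0_iff)
    have "\<mu> \<in> X"
    proof -
      have "card (\<nu> A) \<le> card F" for A
        using F by (intro card_mono) (auto simp: \<nu>_def)
      then show ?thesis
        using cF by (simp add: X_def \<mu>_def PiE_iff)
    qed
    moreover have "\<mu> UNIV = 1"
      using cF by (simp add: \<mu>_def \<nu>_def)
    moreover have "\<mu> (A \<union> B) = \<mu> A + \<mu> B" if "A \<inter> B = {}" for A B
    proof -
      have "\<nu> (A \<union> B) = \<nu> A \<union> \<nu> B" "\<nu> A \<inter> \<nu> B = {}"
        using that by (auto simp: \<nu>_def)
      then show ?thesis
        by (simp add: \<mu>_def card_Un_disjoint fin add_divide_distrib)
    qed
    moreover have "\<bar>\<mu> ((+) s ` A) - \<mu> A\<bar> \<le> 1 / (real m + 1)" if "(s, m) \<in> I" for s m A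
    proof -
      let ?Fs = "(\<lambda>x. x + s) ` F"
      let ?D = "?Fs - F" and ?E = "F - ?Fs"
      have sS: "s \<in> S"
        using that by (force simp: S_def)
      have "m \<le> M"
        unfolding M_def using that \<open>finite I\<close> by (force intro: Max_ge)
      have inj: "inj (\<lambda>x::'g. x + s)"
        by (simp add: inj_def)
      have cFs: "card ?Fs = card F"
        by (rule card_image) (use inj in \<open>auto intro: inj_on_subset\<close>)
      \<comment> \<open>\<open>F\<close> and its translate have the same size, so the one-sided
        bound on \<open>?D\<close> also bounds \<open>?E\<close>; the two differences control the
        two signs of the deviation.\<close>
      have "card ?E = card ?D"
      proof -
        have "card F = card (F \<inter> ?Fs) + card ?E" "card ?Fs = card (F \<inter> ?Fs) + card ?D"
          using F card_Int_Diff[of F ?Fs] card_Int_Diff[of ?Fs F] by (simp_all add: Int_commute)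
        then show ?thesis using cFs by simp
      qed
      have mem: "- x \<in> (+) s ` A \<longleftrightarrow> - (x + s) \<in> A" for x
      proof
        assume "- x \<in> (+) s ` A"
        then obtain a where "a \<in> A" "- x = s + a" by auto
        then have "- (x + s) = a"
          by (metis minus_add minus_add_cancel)
        then show "- (x + s) \<in> A" using \<open>a \<in> A\<close> by simp
      next
        assume "- (x + s) \<in> A"
        moreover have "- x = s + - (x + s)"
          by (metis minus_add add_minus_cancel)
        ultimately show "- x \<in> (+) s ` A" by blast
      qed
      have "card (\<nu> ((+) s ` A)) = card ((\<lambda>x. x + s) ` \<nu> ((+) s ` A))"
        by (rule card_image[symmetric]) (use inj in \<open>auto intro: inj_on_subset\<close>)
      also have "(\<lambda>x. x + s) ` \<nu> ((+) s ` A) = {y\<in>?Fs. - y \<in> A}"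
        using mem by (auto simp: \<nu>_def)
      finally have c: "card (\<nu> ((+) s ` A)) = card {y\<in>?Fs. - y \<in> A}" .
      have "card {y\<in>?Fs. - y \<in> A} \<le> card (\<nu> A \<union> ?D)"
        using F by (intro card_mono) (auto simp: \<nu>_def)
      also have "\<dots> \<le> card (\<nu> A) + card ?D"
        by (rule card_Un_le)
      finally have u: "card (\<nu> ((+) s ` A)) \<le> card (\<nu> A) + card ?D"
        using c by simp
      have "card (\<nu> A) \<le> card ({y\<in>?Fs. - y \<in> A} \<union> ?E)"
        using F by (intro card_mono) (auto simp: \<nu>_def)
      also have "\<dots> \<le> card {y\<in>?Fs. - y \<in> A} + card ?E"
        by (rule card_Un_le)
      finally have l: "card (\<nu> A) \<le> card (\<nu> ((+) s ` A)) + card ?D"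
        using c \<open>card ?E = card ?D\<close> by simp
      have "\<bar>real (card (\<nu> ((+) s ` A))) - real (card (\<nu> A))\<bar> \<le> real (card ?D)"
        using u l by linarith
      also have "\<dots> \<le> 1 / (real M + 1) * real (card F)"
        using Fol[OF sS] .
      finally have "\<bar>real (card (\<nu> ((+) s ` A))) - real (card (\<nu> A))\<bar> / real (card F) \<le> 1 / (real M + 1)"
        using cF by (simp add: pos_divide_le_eq)
      also have "\<dots> \<le> 1 / (real m + 1)"
        using \<open>m \<le> M\<close> by (simp add: frac_le)
      finally show ?thesis
        using cF by (simp add: \<mu>_def flip: diff_divide_distrib)
    qed
    ultimately have "\<mu> \<in> X \<inter> (\<Inter>i\<in>I. K i)"
      by (auto simp: K_def)
    then show ?thesis by blast
  qed
  have "X \<inter> (\<Inter>i\<in>UNIV. K i) \<noteq> {}"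
    by (rule compact_imp_fip_image[OF \<open>compact X\<close> cK fip])
  then obtain \<mu> where "\<mu> \<in> X \<inter> (\<Inter>i\<in>UNIV. K i)"
    by (meson all_not_in_conv)
  then have \<mu>: "\<mu> \<in> X" "\<mu> \<in> K (s, m)" for s m
    by blast+
  have "\<mu> ((+) s ` A) = \<mu> A" for s A
  proof (rule ccontr)
    assume "\<mu> ((+) s ` A) \<noteq> \<mu> A"
    then have "0 < \<bar>\<mu> ((+) s ` A) - \<mu> A\<bar>"
      by simp
    then obtain m where "inverse (real (Suc m)) < \<bar>\<mu> ((+) s ` A) - \<mu> A\<bar>"
      using reals_Archimedean by blast
    then have "1 / (real m + 1) < \<bar>\<mu> ((+) s ` A) - \<mu> A\<bar>"
      by (simp only: inverse_eq_divide of_nat_Suc add.commute)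
    moreover have "\<bar>\<mu> ((+) s ` A) - \<mu> A\<bar> \<le> 1 / (real m + 1)"
      using \<mu>(2)[of s m] by (auto simp: K_def)
    ultimately show False by linarith
  qed
  moreover have "\<mu> UNIV = 1" "\<And>A B. A \<inter> B = {} \<Longrightarrow> \<mu> (A \<union> B) = \<mu> A + \<mu> B"
    using \<mu>(2)[of 0 0] by (auto simp: K_def)
  moreover have "0 \<le> \<mu> A" for A
    using \<mu>(1) by (auto simp: X_def PiE_def Pi_def)
  ultimately show ?thesis
    unfolding amenable_def by blast
qed

text \<open>The element of \<open>S\<close> that moves \<open>F\<close> far depends on
  \<open>F\<close>. Summing over the finite set \<open>S\<close> gives a single linear bound, with
  \<open>K\<close> the inverse of the Folner constant.\<close>

lemma nonamenable_expansion:
  assumes "\<not> amenable TYPE('g::group_add)"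
  obtains S :: "'g::group_add set" and K :: real where "finite S" "K \<ge> 0"
    "\<And>F. finite F \<Longrightarrow> real (card F) \<le> K * (\<Sum>s\<in>S. real (card ((\<lambda>x. x + s) ` F - F)))"
proof -
  have "\<exists>(S :: 'g set) \<epsilon>. finite S \<and> 0 < \<epsilon> \<and> (\<forall>F. finite F \<longrightarrow> F \<noteq> {} \<longrightarrow>
      (\<exists>s\<in>S. \<epsilon> * real (card F) < real (card ((\<lambda>x. x + s) ` F - F))))"
  proof (rule ccontr)
    assume H: "\<not> ?thesis"
    have "amenable TYPE('g)"
    proof (rule amenable_if_Folner)
      fix S :: "'g set" and \<epsilon> :: real assume "finite S" "\<epsilon> > 0"
      then have "\<not> (\<forall>F. finite F \<longrightarrow> F \<noteq> {} \<longrightarrow>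
          (\<exists>s\<in>S. \<epsilon> * real (card F) < real (card ((\<lambda>x. x + s) ` F - F))))"
        using H by blast
      then obtain F where "finite F" "F \<noteq> {}"
        "\<not> (\<exists>s\<in>S. \<epsilon> * real (card F) < real (card ((\<lambda>x. x + s) ` F - F)))"
        by blast
      then show "\<exists>F. finite F \<and> F \<noteq> {} \<and>
          (\<forall>s\<in>S. real (card ((\<lambda>x. x + s) ` F - F)) \<le> \<epsilon> * real (card F))"
        by (intro exI[of _ F]) (simp add: not_less)
    qed
    with assms show False by contradiction
  qed
  then obtain S :: "'g set" and \<epsilon> where S: "finite S" "\<epsilon> > 0" and
    *: "\<And>F. finite F \<Longrightarrow> F \<noteq> {} \<Longrightarrow> \<exists>s\<in>S. \<epsilon> * real (card F) < real (card ((\<lambda>x. x + s) ` F - F))"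
    by auto
  have "real (card F) \<le> 1 / \<epsilon> * (\<Sum>s\<in>S. real (card ((\<lambda>x. x + s) ` F - F)))" if F: "finite F" for F
  proof (cases "F = {}")
    case False
    then obtain s where s: "s \<in> S" "\<epsilon> * real (card F) < real (card ((\<lambda>x. x + s) ` F - F))"
      using * F by blast
    have "real (card ((\<lambda>x. x + s) ` F - F)) \<le> (\<Sum>s\<in>S. real (card ((\<lambda>x. x + s) ` F - F)))"
      using S s by (intro member_le_sum) auto
    with s have "real (card F) * \<epsilon> \<le> (\<Sum>s\<in>S. real (card ((\<lambda>x. x + s) ` F - F)))"
      by (simp add: mult.commute)
    then show ?thesis
      using S by (simp add: field_simps)
  qed auto
  then show ?thesis
    using that[of S "1 / \<epsilon>"] S by auto
qed

section \<open>Linear algebra over the group ring\<close>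

lemma scale_add: "scale a (x + y) = scale a x + scale a y"
  by (rule poly_mapping_eqI) (simp add: lookup_scale lookup_add distrib_left)

lemma scale_left_add: "scale (a + b) x = scale a x + scale b x"
  by (rule poly_mapping_eqI) (simp add: lookup_scale lookup_add distrib_right)

lemma scale_scale: "scale a (scale b x) = scale (a * b) x"
  by (rule poly_mapping_eqI) (simp add: lookup_scale mult.assoc)

lemma scale_zero [simp]: "scale a 0 = 0" "scale 0 x = 0"
  by (rule poly_mapping_eqI, simp add: lookup_scale)+

lemma scale_diff: "scale a (x - y) = scale a x - scale a y"
  by (rule poly_mapping_eqI) (simp add: lookup_scale lookup_minus algebra_simps)

lemma scale_sum: "scale a (\<Sum>i\<in>I. f i) = (\<Sum>i\<in>I. scale a (f i))"
  by (induction I rule: infinite_finite_induct) (auto simp: scale_add)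

lemma submodule_UNIV [simp]: "submodule UNIV"
  by (simp add: submodule_def)

lemma submodule_minus: "submodule M \<Longrightarrow> x \<in> M \<Longrightarrow> - x \<in> M"
proof -
  assume M: "submodule M" "x \<in> M"
  have "scale (- 1) x = - x"
    by (rule poly_mapping_eqI) (simp add: lookup_scale)
  then show ?thesis using M unfolding submodule_def by metis
qed

lemma submodule_diff: "submodule M \<Longrightarrow> x \<in> M \<Longrightarrow> y \<in> M \<Longrightarrow> x - y \<in> M"
  using submodule_minus[of M y] unfolding submodule_def by (metis diff_conv_add_uminus)

lemma submodule_sum:
  assumes "submodule M" "\<And>i. i \<in> I \<Longrightarrow> f i \<in> M"
  shows "(\<Sum>i\<in>I. f i) \<in> M"
  using assms(2)
  by (induction I rule: infinite_finite_induct) (use assms(1) in \<open>auto simp: submodule_def\<close>)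

lemma module_hom_onD:
  assumes "module_hom_on s s' M N f"
  shows "x \<in> M \<Longrightarrow> f x \<in> N"
    and "x \<in> M \<Longrightarrow> y \<in> M \<Longrightarrow> f (x + y) = f x + f y"
    and "x \<in> M \<Longrightarrow> f (s a x) = s' a (f x)"
  using assms by (auto simp: module_hom_on_def)

lemma module_hom_on_zero:
  assumes "module_hom_on s s' M N f" "0 \<in> M"
  shows "f 0 = 0"
  using module_hom_onD(2)[OF assms(1,2,2)] by simp

lemma module_hom_on_diff:
  assumes "module_hom_on scale s' M N f" "submodule M" "x \<in> M" "y \<in> M"
  shows "f (x - y) = f x - f y"
  using module_hom_onD(2)[OF assms(1) submodule_diff[OF assms(2-4)] assms(4)]
  by (simp add: eq_diff_eq)

lemma module_hom_on_sum:
  assumes "module_hom_on scale s' M N f" "submodule M" "\<And>i. i \<in> I \<Longrightarrow> m i \<in> M"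
  shows "f (\<Sum>i\<in>I. m i) = (\<Sum>i\<in>I. f (m i))"
  using assms(3)
proof (induction I rule: infinite_finite_induct)
  case (insert i I)
  then have "f (m i + (\<Sum>i\<in>I. m i)) = f (m i) + f (\<Sum>i\<in>I. m i)"
    by (intro module_hom_onD(2)[OF assms(1)] submodule_sum assms(2)) auto
  then show ?case using insert by simp
qed (use module_hom_on_zero[OF assms(1)] assms(2) in \<open>auto simp: submodule_def\<close>)

lemma module_hom_on_lincomb:
  assumes "module_hom_on scale s' M N f" "submodule M" "\<And>i. i \<in> I \<Longrightarrow> m i \<in> M"
  shows "f (\<Sum>i\<in>I. scale (c i) (m i)) = (\<Sum>i\<in>I. s' (c i) (f (m i)))"
proof -
  have "f (\<Sum>i\<in>I. scale (c i) (m i)) = (\<Sum>i\<in>I. f (scale (c i) (m i)))"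
    by (rule module_hom_on_sum[OF assms(1,2)]) (use assms(2,3) in \<open>auto simp: submodule_def\<close>)
  also have "\<dots> = (\<Sum>i\<in>I. s' (c i) (f (m i)))"
    by (intro sum.cong refl module_hom_onD(3)[OF assms(1)] assms(3))
  finally show ?thesis .
qed

lemma module_hom_on_comp:
  assumes "module_hom_on s s' M N f" "module_hom_on s' s'' N P g"
  shows "module_hom_on s s'' M P (\<lambda>x. g (f x))"
  using assms by (simp add: module_hom_on_def)

lemma module_hom_on_codomain:
  assumes "module_hom_on s s' M N f" "\<And>x. x \<in> M \<Longrightarrow> f x \<in> N'"
  shows "module_hom_on s s' M N' f"
  using assms by (simp add: module_hom_on_def)

lemma module_hom_on_domain:
  assumes "module_hom_on s s' M N f" "M' \<subseteq> M"
  shows "module_hom_on s s' M' N f"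
  using assms unfolding module_hom_on_def by blast

lemma module_hom_on_id: "module_hom_on s s M M (\<lambda>x. x)"
  by (simp add: module_hom_on_def)

lemma module_hom_on_minus:
  assumes "module_hom_on scale scale M N f" "module_hom_on scale scale M N g" "submodule N"
  shows "module_hom_on scale scale M N (\<lambda>x. f x - g x)"
  using assms by (auto simp: module_hom_on_def submodule_diff scale_diff)

lemma module_hom_on_plus:
  assumes "module_hom_on scale scale M N f" "module_hom_on scale scale M N g" "submodule N"
  shows "module_hom_on scale scale M N (\<lambda>x. f x + g x)"
  using assms by (auto simp: module_hom_on_def submodule_def scale_add)

lemma unit_expansion:
  assumes "finite A" "Poly_Mapping.keys y \<subseteq> A"
  shows "y = (\<Sum>b\<in>A. scale (Poly_Mapping.lookup y b) (Poly_Mapping.single b 1))"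
proof (rule poly_mapping_eqI)
  fix t
  have "(\<Sum>b\<in>A. Poly_Mapping.lookup (scale (Poly_Mapping.lookup y b) (Poly_Mapping.single b 1)) t)
      = (\<Sum>b\<in>A. if b = t then Poly_Mapping.lookup y t else 0)"
    by (intro sum.cong) (auto simp: lookup_scale lookup_single when_def)
  also have "\<dots> = Poly_Mapping.lookup y t"
    using assms by (auto simp: in_keys_iff)
  finally show "Poly_Mapping.lookup y t = Poly_Mapping.lookup
      (\<Sum>b\<in>A. scale (Poly_Mapping.lookup y b) (Poly_Mapping.single b 1)) t"
    by (simp add: lookup_sum)
qed

section \<open>Maps out of free modules and lifting through projectives\<close>

definition linear_extension where
  "linear_extension m y = (\<Sum>b\<in>Poly_Mapping.keys y. scale (Poly_Mapping.lookup y b) (m b))"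

lemma linear_extension_superset:
  assumes "finite A" "Poly_Mapping.keys y \<subseteq> A"
  shows "linear_extension m y = (\<Sum>b\<in>A. scale (Poly_Mapping.lookup y b) (m b))"
  unfolding linear_extension_def
  by (rule sum.mono_neutral_left) (use assms in \<open>auto simp: in_keys_iff\<close>)

lemma linear_extension_hom:
  assumes "submodule M" "\<And>b. m b \<in> M"
  shows "module_hom_on scale scale UNIV M (linear_extension m)"
  unfolding module_hom_on_def
proof (intro conjI ballI allI)
  show "linear_extension m x \<in> M" for x
    unfolding linear_extension_def using assms by (intro submodule_sum) (auto simp: submodule_def)
  show "linear_extension m (x + y) = linear_extension m x + linear_extension m y" for x y
  proof -
    let ?A = "Poly_Mapping.keys x \<union> Poly_Mapping.keys y"
    have "linear_extension m z = (\<Sum>b\<in>?A. scale (Poly_Mapping.lookup z b) (m b))"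
      if "z \<in> {x, y, x + y}" for z
      by (rule linear_extension_superset) (use that keys_add[of x y] in auto)
    then show ?thesis
      by (simp add: lookup_add scale_left_add sum.distrib)
  qed
  show "linear_extension m (scale a x) = scale a (linear_extension m x)" for a x
  proof -
    have "Poly_Mapping.keys (scale a x) \<subseteq> Poly_Mapping.keys x"
      by (auto simp: in_keys_iff lookup_scale)
    then have "linear_extension m (scale a x)
        = (\<Sum>b\<in>Poly_Mapping.keys x. scale (Poly_Mapping.lookup (scale a x) b) (m b))"
      by (intro linear_extension_superset) auto
    then show ?thesis
      by (simp add: linear_extension_def scale_sum scale_scale lookup_scale)
  qed
qed

text \<open>Lift the images of the basis vectors, extend linearly and restrict along
  \<open>i\<close>. Only the image of \<open>\<alpha>\<close> has to lie in that of
  \<open>\<beta>\<close>, and the target has its own scalar multiplication \<open>s\<close>, so that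
  boundary maps and the augmentation onto \<open>R\<close> are treated alike.\<close>

lemma projective_lift:
  assumes P: "projective_module P" and \<alpha>: "module_hom_on scale s P N \<alpha>"
    and \<beta>: "module_hom_on scale s M N' \<beta>" and M: "submodule M"
    and sub: "\<And>x. x \<in> P \<Longrightarrow> \<alpha> x \<in> \<beta> ` M"
  shows "\<exists>\<gamma>. module_hom_on scale scale P M \<gamma> \<and> (\<forall>x\<in>P. \<beta> (\<gamma> x) = \<alpha> x)"
proof -
  obtain i p where i: "module_hom_on scale scale P UNIV i"
    and p: "module_hom_on scale scale UNIV P p" and pi: "\<And>x. x \<in> P \<Longrightarrow> p (i x) = x"
    using P unfolding projective_module_def by blast
  have "\<exists>y\<in>M. \<beta> y = \<alpha> (p (Poly_Mapping.single b 1))" for b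
    using sub[of "p (Poly_Mapping.single b 1)"] module_hom_onD(1)[OF p] by force
  then obtain m where m: "\<And>b. m b \<in> M" "\<And>b. \<beta> (m b) = \<alpha> (p (Poly_Mapping.single b 1))"
    by metis
  have ap: "module_hom_on scale s UNIV N (\<lambda>x. \<alpha> (p x))"
    by (rule module_hom_on_comp[OF p \<alpha>])
  have eq: "\<beta> (linear_extension m y) = \<alpha> (p y)" for y
  proof -
    let ?A = "Poly_Mapping.keys y"
    have "\<beta> (linear_extension m y) = (\<Sum>b\<in>?A. s (Poly_Mapping.lookup y b) (\<beta> (m b)))"
      unfolding linear_extension_def by (intro module_hom_on_lincomb[OF \<beta> M] m)
    also have "\<dots> = \<alpha> (p (\<Sum>b\<in>?A. scale (Poly_Mapping.lookup y b) (Poly_Mapping.single b 1)))"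
      by (subst module_hom_on_lincomb[OF ap]) (auto simp: m)
    finally show ?thesis
      using unit_expansion[of ?A y] by simp
  qed
  show ?thesis
  proof (intro exI conjI ballI)
    show "module_hom_on scale scale P M (\<lambda>x. linear_extension m (i x))"
      by (rule module_hom_on_comp[OF i linear_extension_hom[OF M m(1)]])
    show "\<beta> (linear_extension m (i x)) = \<alpha> x" if "x \<in> P" for x
      using eq pi that by simp
  qed
qed

section \<open>Comparison of projective resolutions\<close>

lemma projective_resolutionD:
  assumes "projective_resolution C bd \<epsilon>"
  shows "projective_module (C j)" "submodule (C j)" "0 \<in> C j"
    "module_hom_on scale scale (C (Suc j)) (C j) (bd (Suc j))"
    "module_hom_on scale trivial_scale (C 0) UNIV \<epsilon>"
    "\<epsilon> ` C 0 = UNIV"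
    "x \<in> C 0 \<Longrightarrow> \<epsilon> x = 0 \<Longrightarrow> x \<in> bd (Suc 0) ` C (Suc 0)"
    "y \<in> C (Suc 0) \<Longrightarrow> \<epsilon> (bd (Suc 0) y) = 0"
    "x \<in> C (Suc j) \<Longrightarrow> bd (Suc j) x = 0 \<Longrightarrow> x \<in> bd (Suc (Suc j)) ` C (Suc (Suc j))"
    "y \<in> C (Suc (Suc j)) \<Longrightarrow> bd (Suc j) (bd (Suc (Suc j)) y) = 0"
proof -
  have C: "\<And>j. projective_module (C j)"
    and ex0: "{x \<in> C 0. \<epsilon> x = 0} = bd (Suc 0) ` C (Suc 0)"
    and ex: "\<And>j. {x \<in> C (Suc j). bd (Suc j) x = 0} = bd (Suc (Suc j)) ` C (Suc (Suc j))"
    using assms by (simp_all add: projective_resolution_def)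
  show "projective_module (C j)" "module_hom_on scale scale (C (Suc j)) (C j) (bd (Suc j))"
    "module_hom_on scale trivial_scale (C 0) UNIV \<epsilon>" "\<epsilon> ` C 0 = UNIV"
    using assms by (simp_all add: projective_resolution_def)
  show "submodule (C j)" "0 \<in> C j"
    using C[of j] by (simp_all add: projective_module_def submodule_def)
  show "x \<in> C 0 \<Longrightarrow> \<epsilon> x = 0 \<Longrightarrow> x \<in> bd (Suc 0) ` C (Suc 0)"
    "y \<in> C (Suc 0) \<Longrightarrow> \<epsilon> (bd (Suc 0) y) = 0"
    using ex0 by blast+
  show "x \<in> C (Suc j) \<Longrightarrow> bd (Suc j) x = 0 \<Longrightarrow> x \<in> bd (Suc (Suc j)) ` C (Suc (Suc j))"
    "y \<in> C (Suc (Suc j)) \<Longrightarrow> bd (Suc j) (bd (Suc (Suc j)) y) = 0"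
    using ex[of j] by blast+
qed

lemma chain_map_exists:
  assumes C: "projective_resolution C bd \<epsilon>" and C': "projective_resolution C' bd' \<epsilon>'"
  obtains f where "\<And>j. module_hom_on scale scale (C j) (C' j) (f j)"
    and "\<And>x. x \<in> C 0 \<Longrightarrow> \<epsilon>' (f 0 x) = \<epsilon> x"
    and "\<And>j x. x \<in> C (Suc j) \<Longrightarrow> bd' (Suc j) (f (Suc j) x) = f j (bd (Suc j) x)"
proof -
  note D = projective_resolutionD[OF C] and D' = projective_resolutionD[OF C']
  \<comment> \<open>The last conjunct says that \<open>f\<close> after the boundary can be lifted
    through \<open>bd' (Suc j)\<close>. It makes \<open>P\<close> self-contained, so that each map
    is chosen from its predecessor alone.\<close>
  define P where "P = (\<lambda>j f. module_hom_on scale scale (C j) (C' j) f \<and>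
    (j = 0 \<longrightarrow> (\<forall>x\<in>C 0. \<epsilon>' (f x) = \<epsilon> x)) \<and>
    (\<forall>x\<in>C (Suc j). f (bd (Suc j) x) \<in> bd' (Suc j) ` C' (Suc j)))"
  define Q where "Q = (\<lambda>j f f'. \<forall>x\<in>C (Suc j). bd' (Suc j) (f' x) = f (bd (Suc j) x))"
  have "\<exists>f. P 0 f"
  proof -
    obtain f where f: "module_hom_on scale scale (C 0) (C' 0) f" "\<And>x. x \<in> C 0 \<Longrightarrow> \<epsilon>' (f x) = \<epsilon> x"
      using projective_lift[OF D(1) D(5) D'(5) D'(2)] D'(6) by blast
    have "f (bd (Suc 0) x) \<in> bd' (Suc 0) ` C' (Suc 0)" if "x \<in> C (Suc 0)" for x
    proof (rule D'(7))
      have m: "bd (Suc 0) x \<in> C 0"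
        using that by (rule module_hom_onD(1)[OF D(4)])
      show "f (bd (Suc 0) x) \<in> C' 0"
        using m by (rule module_hom_onD(1)[OF f(1)])
      show "\<epsilon>' (f (bd (Suc 0) x)) = 0"
        using f(2)[OF m] D(8)[OF that] by simp
    qed
    then show ?thesis
      using f by (auto simp: P_def)
  qed
  moreover have "\<exists>f'. P (Suc j) f' \<and> Q j f f'" if "P j f" for j f
  proof -
    have f: "module_hom_on scale scale (C j) (C' j) f"
      "\<And>x. x \<in> C (Suc j) \<Longrightarrow> f (bd (Suc j) x) \<in> bd' (Suc j) ` C' (Suc j)"
      using that by (auto simp: P_def)
    obtain f' where f': "module_hom_on scale scale (C (Suc j)) (C' (Suc j)) f'"
      "\<And>x. x \<in> C (Suc j) \<Longrightarrow> bd' (Suc j) (f' x) = f (bd (Suc j) x)"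
      using projective_lift[OF D(1) module_hom_on_comp[OF D(4) f(1)] D'(4) D'(2)] f(2) by blast
    have "f' (bd (Suc (Suc j)) x) \<in> bd' (Suc (Suc j)) ` C' (Suc (Suc j))" if "x \<in> C (Suc (Suc j))" for x
    proof (rule D'(9))
      have m: "bd (Suc (Suc j)) x \<in> C (Suc j)"
        using that D(4) module_hom_onD(1) by blast
      show "f' (bd (Suc (Suc j)) x) \<in> C' (Suc j)"
        using m f'(1) module_hom_onD(1) by blast
      show "bd' (Suc j) (f' (bd (Suc (Suc j)) x)) = 0"
        using f'(2)[OF m] D(10)[OF that] module_hom_on_zero[OF f(1) D(3)] by simp
    qed
    then show ?thesis
      using f' by (auto simp: P_def Q_def)
  qed
  ultimately obtain f where "\<And>j. P j (f j) \<and> Q j (f j) (f (Suc j))"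
    using dependent_nat_choice[of P Q] by blast
  then show ?thesis
    using that[of f] by (auto simp: P_def Q_def)
qed

text \<open>\<open>u\<close> is a chain map inducing zero on \<open>R\<close>; the intended case is
  the identity minus a chain endomorphism. The homotopy formula is recorded in positive degrees
  only, where cocycles will be compared.\<close>

lemma chain_homotopy_exists:
  assumes C: "projective_resolution C bd \<epsilon>"
    and u: "\<And>j. module_hom_on scale scale (C j) (C j) (u j)"
    and u0: "\<And>x. x \<in> C 0 \<Longrightarrow> \<epsilon> (u 0 x) = 0"
    and ubd: "\<And>j x. x \<in> C (Suc j) \<Longrightarrow> bd (Suc j) (u (Suc j) x) = u j (bd (Suc j) x)"
  obtains h where "\<And>j. module_hom_on scale scale (C j) (C (Suc j)) (h j)"
    and "\<And>j x. x \<in> C (Suc j) \<Longrightarrow> u (Suc j) x = bd (Suc (Suc j)) (h (Suc j) x) + h j (bd (Suc j) x)"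
proof -
  note D = projective_resolutionD[OF C]
  \<comment> \<open>On boundaries the term of the homotopy formula involving the preceding map is
    zero. Restricting the invariant to boundaries thus frees it from that map, and it is exactly
    what the next lift requires.\<close>
  define P where "P = (\<lambda>j h. module_hom_on scale scale (C j) (C (Suc j)) h \<and>
    (\<forall>x\<in>C (Suc j). bd (Suc j) (h (bd (Suc j) x)) = u j (bd (Suc j) x)))"
  define Q where "Q = (\<lambda>j h h'. \<forall>x\<in>C (Suc j). u (Suc j) x = bd (Suc (Suc j)) (h' x) + h (bd (Suc j) x))"
  have bdin: "bd (Suc j) x \<in> C j" if "x \<in> C (Suc j)" for j x
    using that D(4) module_hom_onD(1) by blast
  have "\<exists>h. P 0 h"
  proof -
    have "u 0 x \<in> bd (Suc 0) ` C (Suc 0)" if "x \<in> C 0" for x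
      by (rule D(7)) (use that u u0 module_hom_onD(1) in blast)+
    then obtain h where "module_hom_on scale scale (C 0) (C (Suc 0)) h"
      "\<And>x. x \<in> C 0 \<Longrightarrow> bd (Suc 0) (h x) = u 0 x"
      using projective_lift[OF D(1) u D(4) D(2)] by blast
    then show ?thesis
      using bdin by (auto simp: P_def)
  qed
  moreover have "\<exists>h'. P (Suc j) h' \<and> Q j h h'" if "P j h" for j h
  proof -
    have h: "module_hom_on scale scale (C j) (C (Suc j)) h"
      "\<And>x. x \<in> C (Suc j) \<Longrightarrow> bd (Suc j) (h (bd (Suc j) x)) = u j (bd (Suc j) x)"
      using that by (auto simp: P_def)
    let ?v = "\<lambda>x. u (Suc j) x - h (bd (Suc j) x)"
    have v: "module_hom_on scale scale (C (Suc j)) (C (Suc j)) ?v"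
      by (rule module_hom_on_minus[OF u module_hom_on_comp[OF D(4) h(1)] D(2)])
    have "?v x \<in> bd (Suc (Suc j)) ` C (Suc (Suc j))" if "x \<in> C (Suc j)" for x
    proof (rule D(9))
      show "?v x \<in> C (Suc j)"
        using v that module_hom_onD(1) by blast
      have "bd (Suc j) (?v x) = bd (Suc j) (u (Suc j) x) - bd (Suc j) (h (bd (Suc j) x))"
        using that u h(1) bdin module_hom_onD(1)
        by (intro module_hom_on_diff[OF D(4) D(2)]) blast+
      then show "bd (Suc j) (?v x) = 0"
        using ubd h(2) that by simp
    qed
    then obtain h' where h': "module_hom_on scale scale (C (Suc j)) (C (Suc (Suc j))) h'"
      "\<And>x. x \<in> C (Suc j) \<Longrightarrow> bd (Suc (Suc j)) (h' x) = ?v x"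
      using projective_lift[OF D(1) v D(4) D(2)] by blast
    have "bd (Suc (Suc j)) (h' (bd (Suc (Suc j)) x)) = u (Suc j) (bd (Suc (Suc j)) x)"
      if "x \<in> C (Suc (Suc j))" for x
      using h'(2)[OF bdin[OF that]] D(10)[OF that] module_hom_on_zero[OF h(1) D(3)] by simp
    then show ?thesis
      using h' by (auto simp: P_def Q_def)
  qed
  ultimately obtain h where "\<And>j. P j (h j) \<and> Q j (h j) (h (Suc j))"
    using dependent_nat_choice[of P Q] by blast
  then show ?thesis
    using that[of h] by (auto simp: P_def Q_def)
qed


section \<open>Induced maps on cohomology\<close>

definition pullback where
  "pullback C k f c = (\<lambda>x. if x \<in> C k then c (f x) else 0)"

lemma pullback_cochain:
  assumes "submodule (C k)" "module_hom_on scale scale (C k) N f" "module_hom_on scale (*) N UNIV c"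
  shows "pullback C k f c \<in> cochains C k"
  using assms by (auto simp: pullback_def cochains_def module_hom_on_def submodule_def)

lemma pullback_cocycle:
  assumes C: "projective_resolution C bd \<epsilon>" and C': "projective_resolution C' bd' \<epsilon>'"
    and f: "\<And>j. module_hom_on scale scale (C j) (C' j) (f j)"
    and fbd: "\<And>j x. x \<in> C (Suc j) \<Longrightarrow> bd' (Suc j) (f (Suc j) x) = f j (bd (Suc j) x)"
    and c: "c \<in> cocycles C' bd' k"
  shows "pullback C k (f k) c \<in> cocycles C bd k"
proof -
  note D = projective_resolutionD[OF C] and D' = projective_resolutionD[OF C']
  have "pullback C k (f k) c \<in> cochains C k"
    by (rule pullback_cochain[OF D(2) f]) (use c in \<open>auto simp: cocycles_def cochains_def\<close>)
  moreover have "pullback C k (f k) c (bd (Suc k) x) = 0" if "x \<in> C (Suc k)" for x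
  proof -
    have "pullback C k (f k) c (bd (Suc k) x) = c (bd' (Suc k) (f (Suc k) x))"
      using that module_hom_onD(1)[OF D(4)] by (simp add: pullback_def fbd)
    then show ?thesis
      using c that module_hom_onD(1)[OF f] by (auto simp: cocycles_def)
  qed
  ultimately show ?thesis
    by (simp add: cocycles_def)
qed

text \<open>The identity minus \<open>f\<close> is null-homotopic by some \<open>h\<close>. A
  cocycle \<open>c\<close> kills the part of the homotopy formula that is a boundary, and the rest
  is the coboundary of \<open>c\<close> after \<open>h\<close>.\<close>

lemma chain_endomorphism_cohomology:
  assumes C: "projective_resolution C bd \<epsilon>"
    and f: "\<And>j. module_hom_on scale scale (C j) (C j) (f j)"
    and f0: "\<And>x. x \<in> C 0 \<Longrightarrow> \<epsilon> (f 0 x) = \<epsilon> x"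
    and fbd: "\<And>j x. x \<in> C (Suc j) \<Longrightarrow> bd (Suc j) (f (Suc j) x) = f j (bd (Suc j) x)"
    and c: "c \<in> cocycles C bd (Suc k)"
  obtains b where "b \<in> cochains C k"
    and "\<And>x. x \<in> C (Suc k) \<Longrightarrow> c x = c (f (Suc k) x) + b (bd (Suc k) x)"
proof -
  note D = projective_resolutionD[OF C]
  have bdin: "bd (Suc j) x \<in> C j" if "x \<in> C (Suc j)" for j x
    using that D(4) module_hom_onD(1) by blast
  let ?u = "\<lambda>j x. x - f j x"
  have u: "module_hom_on scale scale (C j) (C j) (?u j)" for j
    by (rule module_hom_on_minus[OF module_hom_on_id f D(2)])
  have "\<epsilon> (?u 0 x) = 0" if "x \<in> C 0" for x
    using module_hom_on_diff[OF D(5,2) that module_hom_onD(1)[OF f that]] f0 that by simp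
  moreover have "bd (Suc j) (?u (Suc j) x) = ?u j (bd (Suc j) x)" if "x \<in> C (Suc j)" for j x
    using module_hom_on_diff[OF D(4,2) that module_hom_onD(1)[OF f that]] fbd that by simp
  ultimately obtain h where h: "\<And>j. module_hom_on scale scale (C j) (C (Suc j)) (h j)"
    and hu: "\<And>j x. x \<in> C (Suc j) \<Longrightarrow> ?u (Suc j) x = bd (Suc (Suc j)) (h (Suc j) x) + h j (bd (Suc j) x)"
    using chain_homotopy_exists[OF C u] by metis
  have ch: "module_hom_on scale (*) (C (Suc k)) UNIV c"
    using c by (auto simp: cocycles_def cochains_def)
  have cin: "h j x \<in> C (Suc j)" if "x \<in> C j" for j x
    using that h module_hom_onD(1) by blast
  show ?thesis
  proof (rule that[of "pullback C k (h k) c"])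
    show "pullback C k (h k) c \<in> cochains C k"
      by (rule pullback_cochain[where N = "C (Suc k)"]) (rule D(2) h ch)+
    fix x assume x: "x \<in> C (Suc k)"
    have "c x - c (f (Suc k) x) = c (?u (Suc k) x)"
      using module_hom_on_diff[OF ch D(2) x module_hom_onD(1)[OF f x]] by simp
    also have "\<dots> = c (bd (Suc (Suc k)) (h (Suc k) x)) + c (h k (bd (Suc k) x))"
      unfolding hu[OF x] using x bdin cin by (intro module_hom_onD(2)[OF ch]) blast+
    also have "c (bd (Suc (Suc k)) (h (Suc k) x)) = 0"
      using c x cin by (auto simp: cocycles_def)
    finally show "c x = c (f (Suc k) x) + pullback C k (h k) c (bd (Suc k) x)"
      using x bdin by (simp add: pullback_def algebra_simps)
  qed
qed

text \<open>The degree is \<open>k + 1\<close>, not \<open>k\<close>; taking \<open>z = 0\<close> expresses that the cohomology vanishes.\<close>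

definition cohomology_generator where
  "cohomology_generator C bd k z \<longleftrightarrow> z \<in> cocycles C bd (Suc k) \<and>
     (\<forall>c\<in>cocycles C bd (Suc k). \<exists>a. \<exists>b\<in>cochains C k.
        \<forall>x\<in>C (Suc k). c x = z x * Poly_Mapping.single 0 a + b (bd (Suc k) x))"

text \<open>With chain maps \<open>f\<close> from \<open>C\<close> to \<open>C'\<close> and
  \<open>g\<close> back, \<open>c\<close> is cohomologous to its pullback along \<open>g\<close>
  after \<open>f\<close>. Its pullback along \<open>g\<close> alone is a right multiple of
  \<open>z\<close> up to a coboundary, and pulling back along \<open>f\<close> respects right
  multiples.\<close>

lemma cohomology_generator_transfer:
  assumes C: "projective_resolution C bd \<epsilon>" and C': "projective_resolution C' bd' \<epsilon>'"
    and z: "cohomology_generator C' bd' k z"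
  obtains f where "cohomology_generator C bd k (pullback C (Suc k) f z)"
proof -
  note D = projective_resolutionD[OF C] and D' = projective_resolutionD[OF C']
  have bdin: "bd (Suc j) x \<in> C j" if "x \<in> C (Suc j)" for j x
    using that D(4) module_hom_onD(1) by blast
  obtain f where f: "\<And>j. module_hom_on scale scale (C j) (C' j) (f j)"
    "\<And>x. x \<in> C 0 \<Longrightarrow> \<epsilon>' (f 0 x) = \<epsilon> x"
    "\<And>j x. x \<in> C (Suc j) \<Longrightarrow> bd' (Suc j) (f (Suc j) x) = f j (bd (Suc j) x)"
    using chain_map_exists[OF C C'] by metis
  obtain g where g: "\<And>j. module_hom_on scale scale (C' j) (C j) (g j)"
    "\<And>x. x \<in> C' 0 \<Longrightarrow> \<epsilon> (g 0 x) = \<epsilon>' x"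
    "\<And>j x. x \<in> C' (Suc j) \<Longrightarrow> bd (Suc j) (g (Suc j) x) = g j (bd' (Suc j) x)"
    using chain_map_exists[OF C' C] by metis
  have fin: "f j x \<in> C' j" if "x \<in> C j" for j x
    using that f(1) module_hom_onD(1) by blast
  show ?thesis
  proof (rule that[of "f (Suc k)"], unfold cohomology_generator_def, intro conjI ballI)
    show "pullback C (Suc k) (f (Suc k)) z \<in> cocycles C bd (Suc k)"
      using pullback_cocycle[OF C C' f(1,3)] z by (simp add: cohomology_generator_def)
    fix c assume c: "c \<in> cocycles C bd (Suc k)"
    have "pullback C' (Suc k) (g (Suc k)) c \<in> cocycles C' bd' (Suc k)"
      by (rule pullback_cocycle[OF C' C g(1,3) c])
    then obtain a b where b: "b \<in> cochains C' k" and
      1: "\<And>y. y \<in> C' (Suc k) \<Longrightarrow> c (g (Suc k) y) = z y * Poly_Mapping.single 0 a + b (bd' (Suc k) y)"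
      using z unfolding cohomology_generator_def by (fastforce simp: pullback_def)
    obtain b' where b': "b' \<in> cochains C k" and
      2: "\<And>x. x \<in> C (Suc k) \<Longrightarrow> c x = c (g (Suc k) (f (Suc k) x)) + b' (bd (Suc k) x)"
      by (rule chain_endomorphism_cohomology[OF C _ _ _ c, of "\<lambda>j x. g j (f j x)"])
        (use f g fin module_hom_on_comp[OF f(1) g(1)] in auto)
    \<comment> \<open>One summand is the primitive found on \<open>C'\<close>, pulled back to
      \<open>C\<close>; the other comes from the homotopy on \<open>C\<close>.\<close>
    let ?b = "\<lambda>x. pullback C k (f k) b x + b' x"
    have "pullback C k (f k) b \<in> cochains C k"
      by (rule pullback_cochain[OF D(2) f(1)]) (use b in \<open>auto simp: cochains_def\<close>)
    then have "?b \<in> cochains C k"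
      using b' by (auto simp: cochains_def module_hom_on_def algebra_simps)
    moreover have "c x = pullback C (Suc k) (f (Suc k)) z x * Poly_Mapping.single 0 a + ?b (bd (Suc k) x)"
      if x: "x \<in> C (Suc k)" for x
      using x 1[OF fin[OF x]] 2[OF x] f(3)[OF x] bdin[OF x] by (simp add: pullback_def add.assoc)
    ultimately show "\<exists>a. \<exists>b\<in>cochains C k. \<forall>x\<in>C (Suc k).
        c x = pullback C (Suc k) (f (Suc k)) z x * Poly_Mapping.single 0 a + b (bd (Suc k) x)"
      by (intro exI[of _ a] bexI[of _ ?b] ballI)
  qed
qed

section \<open>Duality expressed in an arbitrary resolution\<close>

lemma cocycles_right_multiple:
  assumes "f \<in> cocycles C bd k"
  shows "(\<lambda>x. f x * a) \<in> cocycles C bd k"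
  using assms by (auto simp: cocycles_def cochains_def module_hom_on_def distrib_right mult.assoc)

lemma cocycles_diff:
  assumes "f \<in> cocycles C bd k" "f' \<in> cocycles C bd k"
  shows "(\<lambda>x. f x - f' x) \<in> cocycles C bd k"
  using assms by (auto simp: cocycles_def cochains_def module_hom_on_def algebra_simps)

text \<open>The given \<open>C\<close> witnesses that the Hilbert choice behind
  \<open>chosen_resolution\<close> yields a resolution. The duality hypotheses speak about that one
  and are transferred to \<open>C\<close>.\<close>

lemma PD_group_cohomology:
  assumes PD: "PD_group TYPE('g::group_add) TYPE('r::ring_1) (Suc m)"
    and C: "projective_resolution (C :: nat \<Rightarrow> ('g, 'r) ambient set) bd \<epsilon>"
  shows "\<exists>z. cohomology_generator C bd m z"
    and "k > m \<Longrightarrow> c \<in> cocycles C bd (Suc k) \<Longrightarrow>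
      \<exists>b\<in>cochains C k. \<forall>x\<in>C (Suc k). c x = b (bd (Suc k) x)"
proof -
  obtain C' bd' and \<epsilon>' :: "('g, 'r) ambient \<Rightarrow> 'r" where ch: "chosen_resolution = (C', bd', \<epsilon>')"
    using prod_cases3 by blast
  have "case chosen_resolution of (C, bd, \<epsilon> :: ('g, 'r) ambient \<Rightarrow> 'r) \<Rightarrow> projective_resolution C bd \<epsilon>"
    unfolding chosen_resolution_def by (rule someI[of _ "(C, bd, \<epsilon>)"]) (simp add: C)
  then have C': "projective_resolution C' bd' \<epsilon>'"
    by (simp add: ch)
  have [simp]: "group_cocycles k = cocycles C' bd' k" "group_coboundaries k = coboundaries C' bd' k" for k
    by (simp_all add: group_cocycles_def group_coboundaries_def ch)
  obtain \<phi> :: "(('g, 'r) ambient \<Rightarrow> ('g, 'r) group_ring) \<Rightarrow> 'r" where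
    \<phi>: "cohomology_additive_iso (Suc m) \<phi>" and
    \<phi>r: "\<And>f r. f \<in> cocycles C' bd' (Suc m) \<Longrightarrow> \<phi> (\<lambda>x. f x * Poly_Mapping.single 0 r) = \<phi> f * r"
    and van: "\<And>k. k \<noteq> Suc m \<Longrightarrow> cocycles C' bd' k = coboundaries C' bd' k"
    using PD unfolding PD_group_def by auto
  have \<phi>a: "\<phi> (\<lambda>x. f x + f' x) = \<phi> f + \<phi> f'"
    if "f \<in> cocycles C' bd' (Suc m)" "f' \<in> cocycles C' bd' (Suc m)" for f f'
    using \<phi> that by (simp add: cohomology_additive_iso_def)
  have "1 \<in> \<phi> ` cocycles C' bd' (Suc m)"
    using \<phi> by (simp add: cohomology_additive_iso_def)
  then obtain z where z: "z \<in> cocycles C' bd' (Suc m)" "\<phi> z = 1"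
    by auto
  have "cohomology_generator C' bd' m z"
    unfolding cohomology_generator_def
  proof (intro conjI ballI z)
    fix c assume c: "c \<in> cocycles C' bd' (Suc m)"
    \<comment> \<open>Since \<open>\<phi> z = 1\<close> and \<open>\<phi>\<close> is right linear,
      \<open>\<phi>\<close> takes the multiple of \<open>z\<close> by \<open>a\<close> to
      \<open>a\<close>. So \<open>a = \<phi> c\<close> puts the difference into the kernel of
      \<open>\<phi>\<close>, that is, among the coboundaries.\<close>
    let ?za = "\<lambda>x. z x * Poly_Mapping.single 0 (\<phi> c)"
    let ?w = "\<lambda>x. c x - ?za x"
    have za: "?za \<in> cocycles C' bd' (Suc m)"
      by (rule cocycles_right_multiple[OF z(1)])
    have w: "?w \<in> cocycles C' bd' (Suc m)"
      by (rule cocycles_diff[OF c za])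
    have "\<phi> ?w = 0"
    proof -
      have "(\<lambda>x. ?w x + ?za x) = c"
        by simp
      then have "\<phi> c = \<phi> ?w + \<phi> ?za"
        using \<phi>a[OF w za] by (simp only:)
      also have "\<phi> ?za = \<phi> c"
        by (subst \<phi>r[OF z(1)]) (simp only: z(2) mult_1_left)
      finally have "\<phi> ?w + \<phi> c = 0 + \<phi> c"
        by (simp only: add_0_left)
      then show ?thesis
        by (rule add_right_imp_eq)
    qed
    then have "?w \<in> coboundaries C' bd' (Suc m)"
      using \<phi> w by (auto simp: cohomology_additive_iso_def)
    then obtain b where b: "b \<in> cochains C' m"
      "?w = (\<lambda>x. if x \<in> C' (Suc m) then b (bd' (Suc m) x) else 0)"
      by auto
    have "c x = ?za x + b (bd' (Suc m) x)" if "x \<in> C' (Suc m)" for x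
      using fun_cong[OF b(2), of x] that by (simp add: algebra_simps)
    then show "\<exists>a. \<exists>b\<in>cochains C' m. \<forall>x\<in>C' (Suc m).
        c x = z x * Poly_Mapping.single 0 a + b (bd' (Suc m) x)"
      using b(1) by blast
  qed
  then show "\<exists>z. cohomology_generator C bd m z"
    using cohomology_generator_transfer[OF C C'] by metis
  show "\<exists>b\<in>cochains C k. \<forall>x\<in>C (Suc k). c x = b (bd (Suc k) x)"
    if k: "k > m" and c: "c \<in> cocycles C bd (Suc k)" for k c
  proof -
    have "cohomology_generator C' bd' k (\<lambda>x. 0)"
      unfolding cohomology_generator_def
    proof (intro conjI ballI)
      show "(\<lambda>x. 0) \<in> cocycles C' bd' (Suc k)"
        by (simp add: cocycles_def cochains_def module_hom_on_def)
      fix c assume "c \<in> cocycles C' bd' (Suc k)"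
      then obtain b where "b \<in> cochains C' k"
        "c = (\<lambda>x. if x \<in> C' (Suc k) then b (bd' (Suc k) x) else 0)"
        using van[of "Suc k"] k by auto
      then show "\<exists>a. \<exists>b\<in>cochains C' k. \<forall>x\<in>C' (Suc k).
          c x = 0 * Poly_Mapping.single 0 a + b (bd' (Suc k) x)"
        by auto
    qed
    then obtain f :: "('g, 'r) ambient \<Rightarrow> ('g, 'r) ambient"
      where "cohomology_generator C bd k (pullback C (Suc k) f (\<lambda>x. 0))"
      by (rule cohomology_generator_transfer[OF C C']) blast
    then obtain a b where "b \<in> cochains C k"
      "\<forall>x\<in>C (Suc k). c x = pullback C (Suc k) f (\<lambda>x. 0) x * Poly_Mapping.single 0 a + b (bd (Suc k) x)"
      using c unfolding cohomology_generator_def by meson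
    then show ?thesis by (auto simp: pullback_def)
  qed
qed

section \<open>Making two consecutive modules of a resolution free\<close>

definition free_on :: "(nat \<times> ('g::group_add, 'r::ring_1) group_ring) set \<Rightarrow> ('g, 'r) ambient set" where
  "free_on T = {x. Poly_Mapping.keys x \<subseteq> T}"

lemma free_on_iff: "x \<in> free_on T \<longleftrightarrow> (\<forall>t. t \<notin> T \<longrightarrow> Poly_Mapping.lookup x t = 0)"
  by (auto simp: free_on_def in_keys_iff)

lemma submodule_free_on: "submodule (free_on T)"
  by (simp add: submodule_def free_on_iff lookup_add lookup_scale)

abbreviation basis_vector ::
    "nat \<times> ('g, 'r) group_ring \<Rightarrow> ('g::group_add, 'r::ring_1) ambient" where
  "basis_vector t \<equiv> Poly_Mapping.single t 1"

lemma basis_vector_in_free_on: "t \<in> T \<Longrightarrow> basis_vector t \<in> free_on T"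
  by (simp add: free_on_def)

text \<open>Rests on \<open>1 \<noteq> 0\<close> in the group ring, which makes the index
  recoverable from the support.\<close>

lemma inj_basis_vector: "inj basis_vector"
proof (rule injI)
  fix s t :: "nat \<times> ('g::group_add, 'r::ring_1) group_ring"
  assume "(basis_vector s :: ('g, 'r) ambient) = basis_vector t"
  then have "Poly_Mapping.keys (basis_vector s :: ('g, 'r) ambient) = Poly_Mapping.keys (basis_vector t :: ('g, 'r) ambient)"
    by (rule arg_cong)
  then show "s = t"
    by simp
qed

text \<open>An explicit coordinate function gives existence and uniqueness together, and allows the
  definite description in \<open>vector_size\<close> to be evaluated.\<close>

lemma is_coords_free_on:
  assumes T: "finite T" and x: "x \<in> free_on T"
  shows "is_coords (basis_vector ` T) x c \<longleftrightarrow>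
    c = (\<lambda>b. if b \<in> basis_vector ` T then Poly_Mapping.lookup x (inv basis_vector b) else 0)"
    (is "_ \<longleftrightarrow> c = ?c")
proof -
  have inj: "inj_on basis_vector T"
    using inj_basis_vector by (rule inj_on_subset) simp
  have sum: "(\<Sum>b\<in>basis_vector ` T. scale (c b) b) = (\<Sum>t\<in>T. scale (c (basis_vector t)) (basis_vector t))" for c
    by (simp add: sum.reindex[OF inj])
  have look: "Poly_Mapping.lookup (\<Sum>b\<in>basis_vector ` T. scale (c b) b) t = c (basis_vector t)"
    if "t \<in> T" for c t
  proof -
    have "Poly_Mapping.lookup (\<Sum>b\<in>basis_vector ` T. scale (c b) b) t
        = (\<Sum>s\<in>T. if s = t then c (basis_vector t) else 0)"
      unfolding sum lookup_sum
      by (intro sum.cong refl) (auto simp: lookup_scale lookup_single when_def)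
    then show ?thesis
      using T that by simp
  qed
  have c1: "?c (basis_vector t) = Poly_Mapping.lookup x t" if "t \<in> T" for t
    using that by (simp add: inv_f_f[OF inj_basis_vector])
  have "x = (\<Sum>t\<in>T. scale (Poly_Mapping.lookup x t) (basis_vector t))"
    using x by (intro unit_expansion T) (simp add: free_on_def)
  also have "\<dots> = (\<Sum>t\<in>T. scale (?c (basis_vector t)) (basis_vector t))"
    by (intro sum.cong refl) (simp only: c1)
  finally have 1: "is_coords (basis_vector ` T) x ?c"
    by (simp only: is_coords_def sum) simp
  have 2: "c = ?c" if "is_coords (basis_vector ` T) x c"
  proof
    fix b
    show "c b = ?c b"
    proof (cases "b \<in> basis_vector ` T")
      case True
      then obtain t where t: "t \<in> T" "b = basis_vector t" by blast
      have "x = (\<Sum>b\<in>basis_vector ` T. scale (c b) b)"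
        using that by (simp add: is_coords_def)
      then have "c (basis_vector t) = Poly_Mapping.lookup x t"
        using look[OF t(1), of c] by simp
      then show ?thesis
        by (simp only: t(2) c1[OF t(1)])
    next
      case False
      then show ?thesis
        using that by (simp add: is_coords_def)
    qed
  qed
  show ?thesis
  proof
    assume "c = ?c"
    with 1 show "is_coords (basis_vector ` T) x c"
      by (simp only:)
  qed (rule 2)
qed

lemma finite_free_basis_free_on:
  assumes "finite T"
  shows "finite_free_basis (free_on T) (basis_vector ` T)"
  using assms by (auto simp: finite_free_basis_def is_coords_free_on basis_vector_in_free_on)

lemma vector_size_free_on:
  assumes "finite T" "x \<in> free_on T"
  shows "vector_size (basis_vector ` T) x = (\<Sum>t\<in>T. support_size (Poly_Mapping.lookup x t))"
proof -
  have "inj_on basis_vector T"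
    using inj_basis_vector by (rule inj_on_subset) simp
  then show ?thesis
    by (simp add: vector_size_def is_coords_free_on[OF assms] sum.reindex inv_f_f[OF inj_basis_vector])
qed

section \<open>Finitely generated projective modules\<close>

definition truncate where
  "truncate T = linear_extension (\<lambda>t. if t \<in> T then basis_vector t else 0)"

lemma truncate_hom: "module_hom_on scale scale UNIV (free_on T) (truncate T)"
  unfolding truncate_def
  by (rule linear_extension_hom[OF submodule_free_on]) (simp add: free_on_def)

lemma truncate_id:
  assumes "x \<in> free_on T"
  shows "truncate T x = x"
proof -
  have "truncate T x = (\<Sum>b\<in>Poly_Mapping.keys x. scale (Poly_Mapping.lookup x b) (basis_vector b))"
    unfolding truncate_def linear_extension_def
    using assms by (intro sum.cong refl) (auto simp: free_on_def)
  then show ?thesis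
    using unit_expansion[of "Poly_Mapping.keys x" x] by simp
qed

text \<open>Retracts of free modules of finite rank. The retraction \<open>p\<close> is defined on
  the whole ambient module, as in \<open>projective_module\<close>, while \<open>i\<close> is
  confined to finitely many coordinates.\<close>

definition fg_projective :: "('g::group_add, 'r::ring_1) ambient set \<Rightarrow> bool" where
  "fg_projective M \<longleftrightarrow> submodule M \<and>
     (\<exists>T i p. finite T \<and> module_hom_on scale scale M (free_on T) i \<and>
        module_hom_on scale scale UNIV M p \<and> (\<forall>x\<in>M. p (i x) = x))"

lemma fg_projective_imp_projective: "fg_projective M \<Longrightarrow> projective_module M"
  unfolding fg_projective_def projective_module_def
  using module_hom_on_codomain[of scale scale M _ _ UNIV] by blast

lemma fg_projective_free_on: "finite T \<Longrightarrow> fg_projective (free_on T)"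
  unfolding fg_projective_def
  by (rule conjI[OF submodule_free_on], rule exI[of _ T], rule exI[of _ "\<lambda>x. x"],
      rule exI[of _ "truncate T"]) (simp add: module_hom_on_id truncate_hom truncate_id)

lemma fg_projectiveI:
  assumes "projective_module M" "finitely_generated M"
  shows "fg_projective M"
proof -
  obtain i p where M: "submodule M" and i: "module_hom_on scale scale M UNIV i"
    and p: "module_hom_on scale scale UNIV M p" and pi: "\<forall>x\<in>M. p (i x) = x"
    using assms(1) unfolding projective_module_def by blast
  obtain S where S: "finite S" "S \<subseteq> M" "\<And>x. x \<in> M \<Longrightarrow> \<exists>c. x = (\<Sum>b\<in>S. scale (c b) b)"
    using assms(2) unfolding finitely_generated_def by blast
  \<comment> \<open>Finitely many generators involve only finitely many coordinates under
    \<open>i\<close>.\<close>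
  let ?T = "\<Union>b\<in>S. Poly_Mapping.keys (i b)"
  have "i x \<in> free_on ?T" if x: "x \<in> M" for x
  proof -
    obtain c where c: "x = (\<Sum>b\<in>S. scale (c b) b)"
      using S(3)[OF x] ..
    have "i x = (\<Sum>b\<in>S. scale (c b) (i b))"
      unfolding c by (rule module_hom_on_lincomb[OF i M]) (use S in blast)
    also have "\<dots> \<in> free_on ?T"
    proof (rule submodule_sum[OF submodule_free_on])
      fix b assume "b \<in> S"
      then have "i b \<in> free_on ?T"
        by (auto simp: free_on_def)
      then show "scale (c b) (i b) \<in> free_on ?T"
        using submodule_free_on[of ?T] unfolding submodule_def by blast
    qed
    finally show ?thesis .
  qed
  then have "module_hom_on scale scale M (free_on ?T) i"
    by (rule module_hom_on_codomain[OF i])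
  moreover have "finite ?T"
    using S(1) by simp
  ultimately show ?thesis
    unfolding fg_projective_def using M p pi by blast
qed

text \<open>The dual basis lemma. It breaks a map into \<open>M\<close> into finitely many maps to
  \<open>RG\<close>, to which statements about cohomology with coefficients in \<open>RG\<close>
  apply.\<close>

lemma fg_projective_dual_basis:
  fixes M :: "('g::group_add, 'r::ring_1) ambient set"
  assumes "fg_projective M"
  obtains T :: "(nat \<times> ('g, 'r) group_ring) set" and e f where "finite T" "\<And>t. e t \<in> M"
    "\<And>t. module_hom_on scale (*) M UNIV (f t)"
    "\<And>x. x \<in> M \<Longrightarrow> x = (\<Sum>t\<in>T. scale (f t x) (e t))"
proof -
  obtain T i p where T: "finite T" and i: "module_hom_on scale scale M (free_on T) i"
    and p: "module_hom_on scale scale UNIV M p" and pi: "\<And>x. x \<in> M \<Longrightarrow> p (i x) = x"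
    using assms unfolding fg_projective_def by blast
  show ?thesis
  proof (rule that[of T "\<lambda>t. p (basis_vector t)" "\<lambda>t x. Poly_Mapping.lookup (i x) t"])
    show "finite T" by (rule T)
    show "p (basis_vector t) \<in> M" for t
      using module_hom_onD(1)[OF p] by simp
    show "module_hom_on scale (*) M UNIV (\<lambda>x. Poly_Mapping.lookup (i x) t)" for t
      using i by (simp add: module_hom_on_def lookup_add lookup_scale)
    fix x assume x: "x \<in> M"
    have "i x = (\<Sum>t\<in>T. scale (Poly_Mapping.lookup (i x) t) (basis_vector t))"
      using module_hom_onD(1)[OF i x] by (intro unit_expansion T) (simp add: free_on_def)
    then have "p (i x) = p (\<Sum>t\<in>T. scale (Poly_Mapping.lookup (i x) t) (basis_vector t))"
      by (rule arg_cong)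
    also have "\<dots> = (\<Sum>t\<in>T. scale (Poly_Mapping.lookup (i x) t) (p (basis_vector t)))"
      by (rule module_hom_on_lincomb[OF p]) auto
    finally show "x = (\<Sum>t\<in>T. scale (Poly_Mapping.lookup (i x) t) (p (basis_vector t)))"
      using pi[OF x] by simp
  qed
qed

section \<open>Direct sums inside the ambient module\<close>

text \<open>The basis \<open>nat \<times> RG\<close> splits according to the parity of the first component, which
  identifies the ambient module with two copies of itself: \<open>half 0\<close> and \<open>half 1\<close> are the two
  projections and \<open>join\<close> is the inverse of the pair of them.\<close>

definition half :: "nat \<Rightarrow> ('g::group_add, 'r::ring_1) ambient \<Rightarrow> ('g, 'r) ambient" where
  "half b x = Poly_Mapping.Abs_poly_mapping (\<lambda>(m, a). Poly_Mapping.lookup x (2 * m + b, a))"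

definition join :: "('g::group_add, 'r::ring_1) ambient \<Rightarrow> ('g, 'r) ambient \<Rightarrow> ('g, 'r) ambient" where
  "join x y = Poly_Mapping.Abs_poly_mapping
     (\<lambda>(m, a). Poly_Mapping.lookup (if even m then x else y) (m div 2, a))"

lemma lookup_half: "Poly_Mapping.lookup (half b x) (m, a) = Poly_Mapping.lookup x (2 * m + b, a)"
proof -
  have "inj (\<lambda>(m, a). (2 * m + b, a :: ('g, 'r) group_ring))"
    by (auto simp: inj_def)
  then have "finite ((\<lambda>(m, a). (2 * m + b, a)) -` Poly_Mapping.keys x)"
    by (rule finite_vimageI[OF finite_keys])
  also have "(\<lambda>(m, a). (2 * m + b, a)) -` Poly_Mapping.keys x
      = {k. (\<lambda>(m, a). Poly_Mapping.lookup x (2 * m + b, a)) k \<noteq> 0}"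
    by (auto simp: in_keys_iff)
  finally show ?thesis
    by (simp add: half_def)
qed

lemma lookup_join:
  "Poly_Mapping.lookup (join x y) (m, a) = Poly_Mapping.lookup (if even m then x else y) (m div 2, a)"
proof -
  have "{k. (\<lambda>(m, a). Poly_Mapping.lookup (if even m then x else y) (m div 2, a)) k \<noteq> 0}
      \<subseteq> (\<lambda>(m, a). (2 * m, a)) ` Poly_Mapping.keys x \<union> (\<lambda>(m, a). (2 * m + 1, a)) ` Poly_Mapping.keys y"
  proof
    fix k assume "k \<in> {k. (\<lambda>(m, a). Poly_Mapping.lookup (if even m then x else y) (m div 2, a)) k \<noteq> 0}"
    then obtain m a where k: "k = (m, a)" and ne: "Poly_Mapping.lookup (if even m then x else y) (m div 2, a) \<noteq> 0"
      by (cases k) auto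
    show "k \<in> (\<lambda>(m, a). (2 * m, a)) ` Poly_Mapping.keys x \<union> (\<lambda>(m, a). (2 * m + 1, a)) ` Poly_Mapping.keys y"
    proof (cases "even m")
      case True
      then have "k = (\<lambda>(m, a). (2 * m, a)) (m div 2, a)" "(m div 2, a) \<in> Poly_Mapping.keys x"
        using ne k by (simp_all add: in_keys_iff)
      then show ?thesis by blast
    next
      case False
      then have "k = (\<lambda>(m, a). (2 * m + 1, a)) (m div 2, a)" "(m div 2, a) \<in> Poly_Mapping.keys y"
        using ne k by (simp_all add: in_keys_iff)
      then show ?thesis by blast
    qed
  qed
  then have "finite {k. (\<lambda>(m, a). Poly_Mapping.lookup (if even m then x else y) (m div 2, a)) k \<noteq> 0}"
    by (rule finite_subset) simp
  then show ?thesis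
    by (simp add: join_def)
qed

lemma poly_mapping_pair_eqI:
  fixes x y :: "'a \<times> 'b \<Rightarrow>\<^sub>0 'c::zero"
  assumes "\<And>m a. Poly_Mapping.lookup x (m, a) = Poly_Mapping.lookup y (m, a)"
  shows "x = y"
  using assms by (intro poly_mapping_eqI) (metis surj_pair)

lemma half_join [simp]: "half 0 (join x y) = x" "half (Suc 0) (join x y) = y"
  by (rule poly_mapping_pair_eqI, simp add: lookup_half lookup_join)+

lemma join_half: "join (half 0 x) (half (Suc 0) x) = x"
proof (rule poly_mapping_pair_eqI)
  show "Poly_Mapping.lookup (join (half 0 x) (half (Suc 0) x)) (m, a) = Poly_Mapping.lookup x (m, a)" for m a
    by (cases "even m") (simp_all add: lookup_half lookup_join)
qed

lemma half_add: "half b (x + y) = half b x + half b y"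
  by (rule poly_mapping_pair_eqI) (simp add: lookup_half lookup_add)

lemma half_scale: "half b (scale a x) = scale a (half b x)"
  by (rule poly_mapping_pair_eqI) (simp add: lookup_half lookup_scale)

lemma half_zero [simp]: "half b 0 = 0"
  by (rule poly_mapping_pair_eqI) (simp add: lookup_half)

lemma join_add: "join (x + x') (y + y') = join x y + join x' y'"
  by (rule poly_mapping_pair_eqI) (simp add: lookup_join lookup_add)

lemma join_scale: "join (scale a x) (scale a y) = scale a (join x y)"
  by (rule poly_mapping_pair_eqI) (simp add: lookup_join lookup_scale)

lemma join_zero [simp]: "join 0 0 = 0"
  by (rule poly_mapping_pair_eqI) (simp add: lookup_join)

lemma half_hom: "module_hom_on scale scale UNIV UNIV (half b)"
  by (simp add: module_hom_on_def half_add half_scale)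

lemma join_hom:
  assumes "module_hom_on s scale M N f" "module_hom_on s scale M N' g"
  shows "module_hom_on s scale M UNIV (\<lambda>x. join (f x) (g x))"
  using assms by (simp add: module_hom_on_def join_add join_scale)

definition direct_sum where
  "direct_sum M N = {x. half 0 x \<in> M \<and> half (Suc 0) x \<in> N}"

lemma join_in_direct_sum: "join x y \<in> direct_sum M N \<longleftrightarrow> x \<in> M \<and> y \<in> N"
  by (simp add: direct_sum_def)

lemma submodule_direct_sum: "submodule M \<Longrightarrow> submodule N \<Longrightarrow> submodule (direct_sum M N)"
  by (auto simp: submodule_def direct_sum_def half_add half_scale)

lemma fg_projective_direct_sum:
  assumes "fg_projective M" "fg_projective N"
  shows "fg_projective (direct_sum M N)"
proof -
  obtain T i p where T: "finite T" and i: "module_hom_on scale scale M (free_on T) i"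
    and p: "module_hom_on scale scale UNIV M p" and pi: "\<And>x. x \<in> M \<Longrightarrow> p (i x) = x"
    using assms(1) unfolding fg_projective_def by blast
  obtain T' i' p' where T': "finite T'" and i': "module_hom_on scale scale N (free_on T') i'"
    and p': "module_hom_on scale scale UNIV N p'" and pi': "\<And>x. x \<in> N \<Longrightarrow> p' (i' x) = x"
    using assms(2) unfolding fg_projective_def by blast
  let ?T = "(\<lambda>(m, a). (2 * m, a)) ` T \<union> (\<lambda>(m, a). (2 * m + 1, a)) ` T'"
  have sub: "submodule (direct_sum M N)"
    using assms by (simp add: fg_projective_def submodule_direct_sum)
  have h0: "module_hom_on scale scale (direct_sum M N) M (half 0)"
    and h1: "module_hom_on scale scale (direct_sum M N) N (half (Suc 0))"
    by (auto simp: module_hom_on_def direct_sum_def half_add half_scale)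
  have I0: "module_hom_on scale scale (direct_sum M N) UNIV (\<lambda>x. join (i (half 0 x)) (i' (half (Suc 0) x)))"
    by (rule join_hom[OF module_hom_on_comp[OF h0 i] module_hom_on_comp[OF h1 i']])
  have join_free: "join y y' \<in> free_on ?T" if "y \<in> free_on T" "y' \<in> free_on T'" for y y'
    unfolding free_on_iff
  proof (intro allI impI)
    fix t assume t: "t \<notin> ?T"
    obtain m a where ma: "t = (m, a)"
      by (cases t)
    show "Poly_Mapping.lookup (join y y') t = 0"
    proof (cases "even m")
      case True
      then have "t = (\<lambda>(m, a). (2 * m, a)) (m div 2, a)"
        using ma by simp
      then have "(m div 2, a) \<notin> T"
        using t by blast
      then show ?thesis
        using that(1) True ma by (simp add: lookup_join free_on_iff)
    next
      case False
      then have "t = (\<lambda>(m, a). (2 * m + 1, a)) (m div 2, a)"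
        using ma by simp
      then have "(m div 2, a) \<notin> T'"
        using t by blast
      then show ?thesis
        using that(2) False ma by (simp add: lookup_join free_on_iff)
    qed
  qed
  have I: "module_hom_on scale scale (direct_sum M N) (free_on ?T)
      (\<lambda>x. join (i (half 0 x)) (i' (half (Suc 0) x)))"
  proof (rule module_hom_on_codomain[OF I0 join_free])
    fix x assume x: "x \<in> direct_sum M N"
    show "i (half 0 x) \<in> free_on T"
      by (rule module_hom_onD(1)[OF module_hom_on_comp[OF h0 i] x])
    show "i' (half (Suc 0) x) \<in> free_on T'"
      by (rule module_hom_onD(1)[OF module_hom_on_comp[OF h1 i'] x])
  qed
  have P: "module_hom_on scale scale UNIV (direct_sum M N) (\<lambda>x. join (p (half 0 x)) (p' (half (Suc 0) x)))"
  proof (rule module_hom_on_codomain)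
    show "module_hom_on scale scale UNIV UNIV (\<lambda>x. join (p (half 0 x)) (p' (half (Suc 0) x)))"
      by (rule join_hom[OF module_hom_on_comp[OF half_hom p] module_hom_on_comp[OF half_hom p']])
    show "join (p (half 0 x)) (p' (half (Suc 0) x)) \<in> direct_sum M N" for x
      using module_hom_onD(1)[OF p] module_hom_onD(1)[OF p'] by (simp add: join_in_direct_sum)
  qed
  show ?thesis
    unfolding fg_projective_def
  proof (rule conjI[OF sub], rule exI[of _ ?T],
      rule exI[of _ "\<lambda>x. join (i (half 0 x)) (i' (half (Suc 0) x))"],
      rule exI[of _ "\<lambda>x. join (p (half 0 x)) (p' (half (Suc 0) x))"], intro conjI I P ballI)
    show "finite ?T"
      using T T' by simp
    show "join (p (half 0 (join (i (half 0 x)) (i' (half (Suc 0) x)))))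
        (p' (half (Suc 0) (join (i (half 0 x)) (i' (half (Suc 0) x))))) = x"
      if "x \<in> direct_sum M N" for x
      using that pi pi' by (simp add: direct_sum_def join_half)
  qed
qed

text \<open>With \<open>K\<close> the kernel of \<open>p\<close>, the free module
  \<open>free_on T\<close> is \<open>C k\<close> plus \<open>K\<close>. Adding the identity of
  \<open>K\<close>, as a complex in degrees \<open>k + 1\<close> and \<open>k\<close>, preserves
  exactness and makes degree \<open>k\<close> free. Degrees below \<open>k\<close> stay as they
  were, so the construction can be repeated in the next degree without spoiling this one.\<close>

lemma free_replacement:
  fixes C :: "nat \<Rightarrow> ('g::group_add, 'r::ring_1) ambient set"
  assumes C: "projective_resolution C bd \<epsilon>" and fg: "\<And>j. fg_projective (C j)"
    and len: "\<And>j. j > N \<Longrightarrow> C j = {0}"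
  obtains C' bd' \<epsilon>' T N' where "projective_resolution C' bd' \<epsilon>'" "\<And>j. fg_projective (C' j)"
    "\<And>j. j > N' \<Longrightarrow> C' j = {0}" "finite T" "C' k = free_on T" "\<And>j. j < k \<Longrightarrow> C' j = C j"
proof -
  note D = projective_resolutionD[OF C]
  obtain T i p where T: "finite T" and i: "module_hom_on scale scale (C k) (free_on T) i"
    and p: "module_hom_on scale scale UNIV (C k) p" and pi: "\<And>x. x \<in> C k \<Longrightarrow> p (i x) = x"
    using fg[of k] unfolding fg_projective_def by blast
  define K where "K = {x \<in> free_on T. p x = 0}"
  define S where "S = direct_sum (C (Suc k)) K"
  define C' where "C' = (\<lambda>j. if j = k then free_on T else if j = Suc k then S else C j)"
  \<comment> \<open>On \<open>S\<close> the old boundary is embedded by \<open>i\<close>, and the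
    copy of \<open>K\<close> is included as it stands; degree \<open>k + 2\<close> reaches only the
    first half. Out of degree \<open>k\<close> the map \<open>p\<close> discards \<open>K\<close>;
    for \<open>k = 0\<close> this happens in \<open>\<epsilon>'\<close>.\<close>
  define bd' where "bd' = (\<lambda>j x. if j = k then bd k (p x)
    else if j = Suc k then i (bd (Suc k) (half 0 x)) + half (Suc 0) x
    else if j = Suc (Suc k) then join (bd j x) 0 else bd j x)"
  define \<epsilon>' where "\<epsilon>' = (\<lambda>x. if k = 0 then \<epsilon> (p x) else \<epsilon> x)"
  have pF: "module_hom_on scale scale (free_on T) (C k) p"
    by (rule module_hom_on_domain[OF p]) simp
  have i0: "i 0 = 0" and p0: "p 0 = 0" and bd0: "bd (Suc j) 0 = 0" for j
    using module_hom_on_zero[OF i D(3)] module_hom_on_zero[OF p] module_hom_on_zero[OF D(4) D(3)] by auto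
  have bdin: "bd (Suc j) x \<in> C j" if "x \<in> C (Suc j)" for j x
    using that module_hom_onD(1)[OF D(4)] by blast
  have iin: "i x \<in> free_on T" if "x \<in> C k" for x
    using that module_hom_onD(1)[OF i] by blast
  have pin: "p x \<in> C k" for x
    using module_hom_onD(1)[OF p] by blast
  have padd: "p (x + y) = p x + p y" and pdiff: "p (x - y) = p x - p y" for x y
    using module_hom_onD(2)[OF p] module_hom_on_diff[OF p] by auto
  have F: "submodule (free_on T)"
    by (rule submodule_free_on)
  have p_F: "p ` free_on T = C k"
    using pin iin pi by (auto simp: image_iff) metis
  have K: "submodule K"
    using F module_hom_onD(2,3)[OF p] p0 by (simp add: submodule_def K_def)
  have fgK: "fg_projective K"
  proof -
    \<comment> \<open>The projection complementary to \<open>i\<close> after \<open>p\<close>,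
      extended to the ambient module by truncating first.\<close>
    let ?q = "\<lambda>x. truncate T x - i (p (truncate T x))"
    have "module_hom_on scale scale UNIV (free_on T) ?q"
      by (rule module_hom_on_minus[OF truncate_hom module_hom_on_comp[OF module_hom_on_comp[OF truncate_hom pF] i] F])
    moreover have "?q x \<in> K" for x
      using calculation module_hom_onD(1)[of scale scale UNIV "free_on T" ?q] pi[OF pin]
      by (simp add: K_def pdiff)
    ultimately have q: "module_hom_on scale scale UNIV K ?q"
      by (rule module_hom_on_codomain)
    have id: "module_hom_on scale scale K (free_on T) (\<lambda>x. x)"
      by (rule module_hom_on_domain[OF module_hom_on_id]) (auto simp: K_def)
    show ?thesis
      unfolding fg_projective_def
      by (rule conjI[OF K], rule exI[of _ T], rule exI[of _ "\<lambda>x. x"], rule exI[of _ ?q])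
        (intro conjI ballI T id q, simp add: K_def truncate_id i0)
  qed
  have S: "fg_projective S"
    unfolding S_def by (rule fg_projective_direct_sum[OF fg fgK])
  have subS: "submodule S"
    using S by (simp add: fg_projective_def)
  have h0: "module_hom_on scale scale S (C (Suc k)) (half 0)"
    and h1: "module_hom_on scale scale S (free_on T) (half (Suc 0))"
    by (auto simp: module_hom_on_def S_def K_def direct_sum_def half_add half_scale)
  have fg': "fg_projective (C' j)" for j
    using fg S fg_projective_free_on[OF T] by (simp add: C'_def)

  \<comment> \<open>Split \<open>y\<close> as \<open>i (p y)\<close> plus
    \<open>y - i (p y)\<close>: the second part lies in \<open>K\<close> and is always hit, so only
    \<open>p y\<close> matters.\<close>
  have S_image: "bd' (Suc k) ` S = {x \<in> free_on T. p x \<in> bd (Suc k) ` C (Suc k)}"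
  proof (intro equalityI subsetI)
    fix y assume "y \<in> bd' (Suc k) ` S"
    then obtain x where x: "x \<in> S" and y: "y = i (bd (Suc k) (half 0 x)) + half (Suc 0) x"
      by (auto simp: bd'_def)
    have h: "half 0 x \<in> C (Suc k)" "half (Suc 0) x \<in> free_on T" "p (half (Suc 0) x) = 0"
      using x by (auto simp: S_def direct_sum_def K_def)
    have "y \<in> free_on T"
      unfolding y using F iin[OF bdin[OF h(1)]] h(2) by (simp add: submodule_def)
    moreover have "p y = bd (Suc k) (half 0 x)"
      unfolding y by (simp add: padd pi[OF bdin[OF h(1)]] h(3))
    ultimately show "y \<in> {x \<in> free_on T. p x \<in> bd (Suc k) ` C (Suc k)}"
      using h(1) by blast
  next
    fix y assume "y \<in> {x \<in> free_on T. p x \<in> bd (Suc k) ` C (Suc k)}"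
    then obtain l where y: "y \<in> free_on T" and l: "l \<in> C (Suc k)" "p y = bd (Suc k) l"
      by blast
    let ?x = "join l (y - i (p y))"
    have "y - i (p y) \<in> K"
      using submodule_diff[OF F y iin[OF pin]] pi[OF pin] by (simp add: K_def pdiff)
    then have xS: "?x \<in> S"
      using l(1) by (simp add: S_def join_in_direct_sum)
    have "y = bd' (Suc k) ?x"
      using l(2) by (simp add: bd'_def)
    then show "y \<in> bd' (Suc k) ` S"
      using xS by (rule rev_image_eqI[rotated])
  qed

  have S_kernel: "{x \<in> S. bd' (Suc k) x = 0} = (\<lambda>x. join (bd (Suc (Suc k)) x) 0) ` C (Suc (Suc k))"
  proof (intro equalityI subsetI)
    fix x assume "x \<in> {x \<in> S. bd' (Suc k) x = 0}"
    then have x: "x \<in> S" and 0: "i (bd (Suc k) (half 0 x)) + half (Suc 0) x = 0"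
      by (auto simp: bd'_def)
    have h: "half 0 x \<in> C (Suc k)" "half (Suc 0) x \<in> free_on T" "p (half (Suc 0) x) = 0"
      using x by (auto simp: S_def direct_sum_def K_def)
    \<comment> \<open>Applying \<open>p\<close> kills the part in \<open>K\<close> and undoes
      \<open>i\<close>, so the two components vanish separately.\<close>
    have "p (i (bd (Suc k) (half 0 x)) + half (Suc 0) x) = 0"
      unfolding 0 by (rule p0)
    then have z: "bd (Suc k) (half 0 x) = 0"
      by (simp add: padd pi[OF bdin[OF h(1)]] h(3))
    then have "half (Suc 0) x = 0"
      using 0 i0 by simp
    moreover obtain l where "l \<in> C (Suc (Suc k))" "half 0 x = bd (Suc (Suc k)) l"
      using D(9)[OF h(1) z] by blast
    ultimately have "x = join (bd (Suc (Suc k)) l) 0" "l \<in> C (Suc (Suc k))"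
      using join_half[of x] by simp_all
    then show "x \<in> (\<lambda>x. join (bd (Suc (Suc k)) x) 0) ` C (Suc (Suc k))"
      by blast
  next
    fix y assume "y \<in> (\<lambda>x. join (bd (Suc (Suc k)) x) 0) ` C (Suc (Suc k))"
    then obtain x where x: "x \<in> C (Suc (Suc k))" and y: "y = join (bd (Suc (Suc k)) x) 0"
      by blast
    have "y \<in> S"
      using bdin[OF x] K by (simp add: y S_def join_in_direct_sum submodule_def)
    moreover have "bd' (Suc k) y = 0"
      using D(10)[OF x] by (simp add: bd'_def y i0)
    ultimately show "y \<in> {x \<in> S. bd' (Suc k) x = 0}"
      by simp
  qed

  have join0: "join x 0 = 0 \<longleftrightarrow> x = 0" for x :: "('g, 'r) ambient"
    by (metis half_join(1) half_zero join_zero)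

  have exact0: "{x \<in> C 0. \<epsilon> x = 0} = bd (Suc 0) ` C (Suc 0)"
    using D(7,8) bdin by blast
  have exact: "{x \<in> C (Suc j). bd (Suc j) x = 0} = bd (Suc (Suc j)) ` C (Suc (Suc j))" for j
    using D(9,10) bdin by blast

  have res: "projective_resolution C' bd' \<epsilon>'"
    unfolding projective_resolution_def
  proof (intro conjI allI)
    show "projective_module (C' j)" for j
      by (rule fg_projective_imp_projective[OF fg'])
    show "module_hom_on scale scale (C' (Suc j)) (C' j) (bd' (Suc j))" for j
    proof -
      consider "Suc j = k" | "j = k" | "j = Suc k" | "Suc j \<noteq> k" "j \<noteq> k" "j \<noteq> Suc k"
        by blast
      then show ?thesis
      proof cases
        case 1
        then have "module_hom_on scale scale (free_on T) (C j) (\<lambda>x. bd (Suc j) (p x))"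
          using module_hom_on_comp[OF pF] D(4) by blast
        then show ?thesis
          using 1 by (auto simp: C'_def bd'_def)
      next
        case 2
        have "module_hom_on scale scale S (free_on T) (\<lambda>x. i (bd (Suc k) (half 0 x)) + half (Suc 0) x)"
          by (rule module_hom_on_plus[OF module_hom_on_comp[OF module_hom_on_comp[OF h0 D(4)] i] h1 F])
        then show ?thesis
          using 2 by (simp add: C'_def bd'_def)
      next
        case 3
        have "module_hom_on scale scale (C (Suc (Suc k))) UNIV (\<lambda>x. join (bd (Suc (Suc k)) x) 0)"
          by (rule join_hom[OF D(4), where N' = UNIV]) (simp add: module_hom_on_def)
        then have "module_hom_on scale scale (C (Suc (Suc k))) S (\<lambda>x. join (bd (Suc (Suc k)) x) 0)"
          by (rule module_hom_on_codomain) (use S_kernel in blast)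
        then show ?thesis
          using 3 by (simp add: C'_def bd'_def)
      next
        case 4
        then show ?thesis
          using D(4)[of j] by (simp add: C'_def bd'_def)
      qed
    qed
    show "module_hom_on scale trivial_scale (C' 0) UNIV \<epsilon>'"
    proof (cases "k = 0")
      case True
      then show ?thesis
        using module_hom_on_comp[OF pF, of trivial_scale UNIV \<epsilon>] D(5) by (simp add: C'_def \<epsilon>'_def)
    next
      case False
      then show ?thesis
        using D(5) by (simp add: C'_def \<epsilon>'_def)
    qed
    show "\<epsilon>' ` C' 0 = UNIV"
    proof (cases "k = 0")
      case True
      then have "\<epsilon>' ` C' 0 = \<epsilon> ` p ` free_on T"
        by (simp add: C'_def \<epsilon>'_def image_image)
      then show ?thesis
        using p_F D(6) True by simp
    next
      case False
      then show ?thesis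
        using D(6) by (simp add: C'_def \<epsilon>'_def)
    qed
    show "{x \<in> C' 0. \<epsilon>' x = 0} = bd' 1 ` C' 1"
    proof -
      consider "k = 0" | "k = Suc 0" | "k \<noteq> 0" "k \<noteq> Suc 0"
        by blast
      then show ?thesis
      proof cases
        case 1
        have "{x \<in> C' 0. \<epsilon>' x = 0} = {x \<in> free_on T. p x \<in> {y \<in> C 0. \<epsilon> y = 0}}"
          using 1 pin by (auto simp: C'_def \<epsilon>'_def)
        also have "\<dots> = bd' (Suc k) ` S"
          unfolding exact0 S_image using 1 by simp
        finally show ?thesis
          using 1 by (simp add: C'_def)
      next
        case 2
        have "bd' 1 ` C' 1 = bd (Suc 0) ` p ` free_on T"
          using 2 by (simp add: C'_def bd'_def image_image)
        then show ?thesis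
          using exact0 p_F 2 by (simp add: C'_def \<epsilon>'_def)
      next
        case 3
        then show ?thesis
          using exact0 by (simp add: C'_def \<epsilon>'_def bd'_def)
      qed
    qed
    show "{x \<in> C' (Suc j). bd' (Suc j) x = 0} = bd' (Suc (Suc j)) ` C' (Suc (Suc j))" for j
    proof -
      consider "Suc (Suc j) = k" | "Suc j = k" | "j = k" | "j = Suc k"
        | "Suc (Suc j) \<noteq> k" "Suc j \<noteq> k" "j \<noteq> k" "j \<noteq> Suc k"
        by blast
      then show ?thesis
      proof cases
        case 1
        have "bd' (Suc (Suc j)) ` C' (Suc (Suc j)) = bd (Suc (Suc j)) ` p ` free_on T"
          using 1 by (auto simp: C'_def bd'_def image_image)
        also have "\<dots> = bd (Suc (Suc j)) ` C (Suc (Suc j))"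
          using p_F 1 by simp
        finally show ?thesis
          using exact[of j] 1 by (auto simp: C'_def bd'_def)
      next
        case 2
        have "{x \<in> C' (Suc j). bd' (Suc j) x = 0} = {x \<in> free_on T. p x \<in> {y \<in> C (Suc j). bd (Suc j) y = 0}}"
          using 2 pin by (auto simp: C'_def bd'_def)
        also have "\<dots> = bd' (Suc k) ` S"
          unfolding exact S_image using 2 by simp
        finally show ?thesis
          using 2 by (auto simp: C'_def)
      next
        case 3
        then show ?thesis
          using S_kernel by (simp add: C'_def bd'_def)
      next
        case 4
        then show ?thesis
          using exact[of j] by (simp add: C'_def bd'_def join0)
      next
        case 5
        then show ?thesis
          using exact[of j] by (simp add: C'_def bd'_def)
      qed
    qed
  qed
  \<comment> \<open>The bound exceeds both \<open>N\<close> and the altered degrees \<open>k\<close>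
    and \<open>k + 1\<close>, which may be nonzero beyond \<open>N\<close>.\<close>
  have len': "C' j = {0}" if "j > N + Suc k" for j
    using that len[of j] by (simp add: C'_def)
  have eq: "C' k = free_on T" "\<And>j. j < k \<Longrightarrow> C' j = C j"
    by (simp_all add: C'_def)
  show ?thesis
    by (rule that[OF res fg' len' T eq])
qed

section \<open>Splitting off the boundaries\<close>

lemma module_hom_on_coordinates:
  assumes "\<And>t. module_hom_on scale (*) M UNIV (b t)" "submodule N" "\<And>t. e t \<in> N"
  shows "module_hom_on scale scale M N (\<lambda>x. \<Sum>t\<in>T. scale (b t x) (e t))"
  unfolding module_hom_on_def
proof (intro conjI ballI allI)
  show "(\<Sum>t\<in>T. scale (b t x) (e t)) \<in> N" for x
    using assms(2,3) by (intro submodule_sum) (auto simp: submodule_def)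
  show "(\<Sum>t\<in>T. scale (b t (x + y)) (e t)) = (\<Sum>t\<in>T. scale (b t x) (e t)) + (\<Sum>t\<in>T. scale (b t y) (e t))"
    if "x \<in> M" "y \<in> M" for x y
    using module_hom_onD(2)[OF assms(1) that] by (simp add: scale_left_add sum.distrib)
  show "(\<Sum>t\<in>T. scale (b t (scale a x)) (e t)) = scale a (\<Sum>t\<in>T. scale (b t x) (e t))"
    if "x \<in> M" for a x
    using module_hom_onD(3)[OF assms(1) that] by (simp add: scale_sum scale_scale)
qed

text \<open>Induction from the end of the resolution: the projection along the boundaries in degree
  \<open>j + 1\<close> has cocycles as coordinates, which therefore factor through \<open>bd (Suc j)\<close>.\<close>

lemma boundary_splitting:
  fixes C :: "nat \<Rightarrow> ('g::group_add, 'r::ring_1) ambient set"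
  assumes C: "projective_resolution C bd \<epsilon>" and fg: "\<And>j. fg_projective (C j)"
    and len: "\<And>j. j > N \<Longrightarrow> C j = {0}"
    and van: "\<And>k c. k > m \<Longrightarrow> c \<in> cocycles C bd (Suc k) \<Longrightarrow>
      \<exists>b\<in>cochains C k. \<forall>x\<in>C (Suc k). c x = b (bd (Suc k) x)"
    and j: "j > m"
  shows "\<exists>r. module_hom_on scale scale (C j) (C (Suc j)) r \<and>
    (\<forall>x\<in>C (Suc j). bd (Suc j) (r (bd (Suc j) x)) = bd (Suc j) x)"
  using j
proof (induction "N - j" arbitrary: j)
  case 0
  note D = projective_resolutionD[OF C]
  \<comment> \<open>\<open>N - j = 0\<close> means \<open>j \<ge> N\<close>, so there are no nonzero
    boundaries to split off.\<close>
  have "C (Suc j) = {0}"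
    using 0 by (intro len) simp
  moreover have "bd (Suc j) 0 = 0"
    by (rule module_hom_on_zero[OF D(4) D(3)])
  ultimately show ?case
    by (intro exI[of _ "\<lambda>x. 0"]) (simp add: module_hom_on_def)
next
  case (Suc l)
  note D = projective_resolutionD[OF C]
  have bdin: "bd (Suc j) x \<in> C j" if "x \<in> C (Suc j)" for j x
    using that by (rule module_hom_onD(1)[OF D(4)])
  have "l = N - Suc j" "Suc j > m"
    using Suc.hyps(2) Suc.prems by auto
  then obtain r where r: "module_hom_on scale scale (C (Suc j)) (C (Suc (Suc j))) r"
    and bdr: "\<And>x. x \<in> C (Suc (Suc j)) \<Longrightarrow>
      bd (Suc (Suc j)) (r (bd (Suc (Suc j)) x)) = bd (Suc (Suc j)) x"
    using Suc.hyps(1)[of "Suc j"] by blast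
  \<comment> \<open>By the choice of \<open>r\<close> this map vanishes on boundaries, which is the
    cocycle condition for each of its coordinates \<open>f t\<close>.\<close>
  let ?p = "\<lambda>x. x - bd (Suc (Suc j)) (r x)"
  have p: "module_hom_on scale scale (C (Suc j)) (C (Suc j)) ?p"
    by (rule module_hom_on_minus[OF module_hom_on_id module_hom_on_comp[OF r D(4)] D(2)])
  obtain T :: "(nat \<times> ('g, 'r) group_ring) set" and e f where T: "finite T" and e: "\<And>t. e t \<in> C (Suc j)"
    and f: "\<And>t. module_hom_on scale (*) (C (Suc j)) UNIV (f t)"
    and ef: "\<And>x. x \<in> C (Suc j) \<Longrightarrow> x = (\<Sum>t\<in>T. scale (f t x) (e t))"
    by (rule fg_projective_dual_basis[OF fg[of "Suc j"]]) blast
  have "pullback C (Suc j) ?p (f t) \<in> cocycles C bd (Suc j)" for t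
  proof -
    have "pullback C (Suc j) ?p (f t) \<in> cochains C (Suc j)"
      by (rule pullback_cochain[where C = C and k = "Suc j", OF D(2) p f])
    moreover have "f t 0 = 0"
      by (rule module_hom_on_zero[OF f D(3)])
    ultimately show ?thesis
      using bdr by (simp add: cocycles_def pullback_def)
  qed
  then have "\<exists>b. b \<in> cochains C j \<and> (\<forall>x\<in>C (Suc j). pullback C (Suc j) ?p (f t) x = b (bd (Suc j) x))" for t
    using van[OF Suc.prems] by blast
  then obtain b where b: "\<And>t. b t \<in> cochains C j"
    and bp: "\<And>t x. x \<in> C (Suc j) \<Longrightarrow> f t (?p x) = b t (bd (Suc j) x)"
    by (simp add: pullback_def) metis
  \<comment> \<open>Reassembling the factored coordinates gives
    \<open>?r (bd (Suc j) x) = ?p x\<close>. As \<open>?p x\<close> differs from \<open>x\<close> by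
    a boundary, both have the same image under \<open>bd (Suc j)\<close>.\<close>
  let ?r = "\<lambda>y. \<Sum>t\<in>T. scale (b t y) (e t)"
  have "module_hom_on scale scale (C j) (C (Suc j)) ?r"
    by (rule module_hom_on_coordinates[OF _ D(2) e]) (use b in \<open>simp add: cochains_def\<close>)
  moreover have "bd (Suc j) (?r (bd (Suc j) x)) = bd (Suc j) x" if x: "x \<in> C (Suc j)" for x
  proof -
    have px: "?p x \<in> C (Suc j)"
      by (rule module_hom_onD(1)[OF p x])
    have rx: "r x \<in> C (Suc (Suc j))"
      by (rule module_hom_onD(1)[OF r x])
    have "?r (bd (Suc j) x) = (\<Sum>t\<in>T. scale (f t (?p x)) (e t))"
      using bp[OF x] by simp
    also have "\<dots> = ?p x"
      by (rule ef[OF px, symmetric])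
    finally have "bd (Suc j) (?r (bd (Suc j) x)) = bd (Suc j) (?p x)"
      by (rule arg_cong)
    also have "\<dots> = bd (Suc j) x - bd (Suc j) (bd (Suc (Suc j)) (r x))"
      by (rule module_hom_on_diff[OF D(4) D(2) x bdin[OF rx]])
    finally show ?thesis
      using D(10)[OF rx] by simp
  qed
  ultimately show ?case
    by blast
qed

section \<open>Support sizes\<close>

lemma support_size_add: "support_size (x + y) \<le> support_size x + support_size y"
proof -
  have "card (Poly_Mapping.keys (x + y)) \<le> card (Poly_Mapping.keys x \<union> Poly_Mapping.keys y)"
    by (rule card_mono) (use keys_add[of x y] in auto)
  also have "\<dots> \<le> card (Poly_Mapping.keys x) + card (Poly_Mapping.keys y)"
    by (rule card_Un_le)
  finally show ?thesis
    by (simp add: support_size_def)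
qed

lemma support_size_sum: "support_size (\<Sum>i\<in>I. f i) \<le> (\<Sum>i\<in>I. support_size (f i))"
proof (induction I rule: infinite_finite_induct)
  case (insert i I)
  then show ?case
    using support_size_add[of "f i" "\<Sum>i\<in>I. f i"] by simp
qed (simp_all add: support_size_def)

lemma support_size_mult: "support_size (x * y) \<le> support_size x * support_size y"
proof -
  let ?P = "Poly_Mapping.keys x \<times> Poly_Mapping.keys y"
  have "Poly_Mapping.keys (x * y) \<subseteq> (\<lambda>(a, b). a + b) ` ?P"
    using keys_mult[of x y] by auto
  then have "card (Poly_Mapping.keys (x * y)) \<le> card ((\<lambda>(a, b). a + b) ` ?P)"
    by (intro card_mono) auto
  also have "\<dots> \<le> card ?P"
    by (rule card_image_le) simp
  finally show ?thesis
    by (simp add: support_size_def card_cartesian_product)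
qed

text \<open>Coefficients may be annihilated by \<open>a\<close>, hence only an inequality. What
  matters is that the bound is independent of \<open>a\<close>.\<close>

lemma support_size_scalar: "support_size (x * Poly_Mapping.single g a) \<le> support_size x"
proof -
  have "support_size (Poly_Mapping.single g a) \<le> 1"
    by (simp add: support_size_def)
  then have "support_size x * support_size (Poly_Mapping.single g a) \<le> support_size x * 1"
    by (rule mult_le_mono2)
  then show ?thesis
    using order_trans[OF support_size_mult] by (simp only: mult_1_right)
qed

text \<open>The constant is the total support size of the values on the basis vectors. This is where
  finite rank turns a coboundary \<open>b (bd d)\<close> into a quantity linear in the size of
  \<open>bd d\<close>.\<close>

lemma cochain_bounded:
  fixes T :: "(nat \<times> ('g::group_add, 'r::ring_1) group_ring) set"
  assumes T: "finite T" and b: "module_hom_on scale (*) (free_on T) UNIV b"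
  obtains A :: real where "A \<ge> 0" and
    "\<And>y. y \<in> free_on T \<Longrightarrow> real (support_size (b y)) \<le> A * real (\<Sum>t\<in>T. support_size (Poly_Mapping.lookup y t))"
proof (rule that)
  let ?A = "\<Sum>t\<in>T. support_size (b (basis_vector t))"
  show "0 \<le> real ?A"
    by (rule of_nat_0_le_iff)
  fix y assume y: "y \<in> free_on T"
  have "b y = b (\<Sum>t\<in>T. scale (Poly_Mapping.lookup y t) (basis_vector t))"
    by (rule arg_cong[OF unit_expansion[OF T]]) (use y in \<open>simp add: free_on_def\<close>)
  also have "\<dots> = (\<Sum>t\<in>T. Poly_Mapping.lookup y t * b (basis_vector t))"
    by (rule module_hom_on_lincomb[OF b submodule_free_on basis_vector_in_free_on])
  finally have "support_size (b y) \<le> (\<Sum>t\<in>T. support_size (Poly_Mapping.lookup y t * b (basis_vector t)))"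
    by (simp only: support_size_sum)
  also have "\<dots> \<le> (\<Sum>t\<in>T. support_size (Poly_Mapping.lookup y t) * ?A)"
  proof (rule sum_mono)
    fix t assume "t \<in> T"
    then have "support_size (b (basis_vector t)) \<le> ?A"
      using T by (intro member_le_sum) auto
    then have "support_size (Poly_Mapping.lookup y t) * support_size (b (basis_vector t))
        \<le> support_size (Poly_Mapping.lookup y t) * ?A"
      by (rule mult_le_mono2)
    then show "support_size (Poly_Mapping.lookup y t * b (basis_vector t))
        \<le> support_size (Poly_Mapping.lookup y t) * ?A"
      using support_size_mult order_trans by blast
  qed
  also have "\<dots> = ?A * (\<Sum>t\<in>T. support_size (Poly_Mapping.lookup y t))"
    by (simp only: sum_distrib_right[symmetric] mult.commute)
  finally have "real (support_size (b y)) \<le> real (?A * (\<Sum>t\<in>T. support_size (Poly_Mapping.lookup y t)))"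
    by (rule of_nat_mono)
  then show "real (support_size (b y)) \<le> real ?A * real (\<Sum>t\<in>T. support_size (Poly_Mapping.lookup y t))"
    by (simp only: of_nat_mult)
qed

text \<open>Multiplication by the group element \<open>s\<close> translates the support without
  loss, while the product with the scalar \<open>a\<close> is supported within that of
  \<open>x\<close>; outside the latter nothing can cancel.\<close>

lemma translate_support_diff:
  fixes x :: "('g::group_add, 'r::ring_1) group_ring"
  shows "(\<lambda>g. g + s) ` Poly_Mapping.keys x - Poly_Mapping.keys x
    \<subseteq> Poly_Mapping.keys (x * Poly_Mapping.single s 1 - x * Poly_Mapping.single 0 a)"
proof
  fix h assume "h \<in> (\<lambda>g. g + s) ` Poly_Mapping.keys x - Poly_Mapping.keys x"
  then obtain g where g: "g \<in> Poly_Mapping.keys x" "h = g + s" "h \<notin> Poly_Mapping.keys x"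
    by blast
  let ?y = "x * Poly_Mapping.single s 1"
  \<comment> \<open>\<open>keys_mult\<close> bounds supports only from above. Undoing the
    translation by \<open>- s\<close> gives the bound from below that is needed for
    \<open>?y\<close>.\<close>
  have "x = ?y * Poly_Mapping.single (- s) 1"
    by (simp add: mult.assoc mult_single)
  then have "g \<in> Poly_Mapping.keys (?y * Poly_Mapping.single (- s) 1)"
    using g(1) by simp
  then obtain h' where "h' \<in> Poly_Mapping.keys ?y" "g = h' + - s"
    using keys_mult[of ?y "Poly_Mapping.single (- s) 1"] by (auto split: if_splits)
  then have "h \<in> Poly_Mapping.keys ?y"
    using g(2) by simp
  moreover have "h \<notin> Poly_Mapping.keys (x * Poly_Mapping.single 0 a)"
    using keys_mult[of x "Poly_Mapping.single 0 a"] g(3) by (auto split: if_splits)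
  ultimately show "h \<in> Poly_Mapping.keys (?y - x * Poly_Mapping.single 0 a)"
    by (simp add: in_keys_iff lookup_minus)
qed

section \<open>The isoperimetric inequality\<close>

lemma linear_isoperimetric_if_nonamenable:
  fixes C :: "nat \<Rightarrow> ('g::group_add, 'r::ring_1) ambient set"
  assumes C: "projective_resolution C bd \<epsilon>"
    and T: "finite T" "C m = free_on T" and T': "finite T'" "C (Suc m) = free_on T'"
    and z: "cohomology_generator C bd m z"
    and r: "module_hom_on scale scale (C (Suc m)) (C (Suc (Suc m))) r"
    and bdr: "\<And>x. x \<in> C (Suc (Suc m)) \<Longrightarrow>
      bd (Suc (Suc m)) (r (bd (Suc (Suc m)) x)) = bd (Suc (Suc m)) x"
    and na: "\<not> amenable TYPE('g)"
  shows "linear_isoperimetric m C bd (basis_vector ` T) (basis_vector ` T')"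
proof -
  note D = projective_resolutionD[OF C]
  have bdin: "bd (Suc j) x \<in> C j" if "x \<in> C (Suc j)" for j x
    using that by (rule module_hom_onD(1)[OF D(4)])
  let ?p = "\<lambda>x. x - bd (Suc (Suc m)) (r x)"
  let ?v = "\<lambda>y. real (\<Sum>t\<in>T. support_size (Poly_Mapping.lookup y t))"
  have zc: "z \<in> cocycles C bd (Suc m)"
    using z by (simp add: cohomology_generator_def)
  have p: "module_hom_on scale scale (C (Suc m)) (C (Suc m)) ?p"
    by (rule module_hom_on_minus[OF module_hom_on_id module_hom_on_comp[OF r D(4)] D(2)])
  have bdp: "bd (Suc m) (?p d) = bd (Suc m) d" if d: "d \<in> C (Suc m)" for d
  proof -
    have rd: "r d \<in> C (Suc (Suc m))"
      by (rule module_hom_onD(1)[OF r d])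
    show ?thesis
      using module_hom_on_diff[OF D(4) D(2) d bdin[OF rd]] D(10)[OF rd] by simp
  qed
  \<comment> \<open>\<open>P c a A\<close>: up to an error linear in the boundary, \<open>c\<close>
    is the right multiple of \<open>z\<close> by \<open>a\<close>. It is applied to the translates
    of \<open>z\<close> and later to the coordinates of \<open>?p\<close>.\<close>
  define P where "P = (\<lambda>c a A. A \<ge> 0 \<and> (\<forall>d\<in>C (Suc m).
      real (support_size (c d - z d * Poly_Mapping.single 0 a)) \<le> A * ?v (bd (Suc m) d)))"
  have coordinate: "\<exists>a A. P c a A"
    if c: "c \<in> cocycles C bd (Suc m)" for c
  proof -
    obtain a b where b: "b \<in> cochains C m"
      and cb: "\<And>x. x \<in> C (Suc m) \<Longrightarrow> c x = z x * Poly_Mapping.single 0 a + b (bd (Suc m) x)"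
      using z c unfolding cohomology_generator_def by meson
    have "module_hom_on scale (*) (free_on T) UNIV b"
      using b T(2) by (simp add: cochains_def)
    then obtain A :: real where A: "A \<ge> 0"
      "\<And>y. y \<in> free_on T \<Longrightarrow> real (support_size (b y)) \<le> A * ?v y"
      using cochain_bounded[OF T(1)] by blast
    have "real (support_size (c d - z d * Poly_Mapping.single 0 a)) \<le> A * ?v (bd (Suc m) d)"
      if d: "d \<in> C (Suc m)" for d
      using A(2)[of "bd (Suc m) d"] bdin[OF d] T(2) cb[OF d] by simp
    with A(1) show ?thesis
      unfolding P_def by blast
  qed

  obtain S :: "'g set" and K :: real where S: "finite S" "K \<ge> 0"
    and SK: "\<And>F. finite F \<Longrightarrow> real (card F) \<le> K * (\<Sum>s\<in>S. real (card ((\<lambda>x. x + s) ` F - F)))"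
    using nonamenable_expansion[OF na] by blast
  have "(\<lambda>x. z x * Poly_Mapping.single s 1) \<in> cocycles C bd (Suc m)" for s
    by (rule cocycles_right_multiple[OF zc])
  from coordinate[OF this] obtain a A where "\<And>s. P (\<lambda>x. z x * Poly_Mapping.single s 1) (a s) (A s)"
    by metis
  then have A: "A s \<ge> (0::real)"
    "d \<in> C (Suc m) \<Longrightarrow> real (support_size
      (z d * Poly_Mapping.single s 1 - z d * Poly_Mapping.single 0 (a s))) \<le> A s * ?v (bd (Suc m) d)" for s d
    by (simp_all add: P_def)
  \<comment> \<open>The errors \<open>A s\<close> bound how far each \<open>s\<close> moves the
    support of \<open>z d\<close>; expansion converts their sum, times \<open>K\<close>, into a
    bound on that support.\<close>
  have z_bound: "real (support_size (z d)) \<le> K * (\<Sum>s\<in>S. A s) * ?v (bd (Suc m) d)"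
    if d: "d \<in> C (Suc m)" for d
  proof -
    let ?F = "Poly_Mapping.keys (z d)"
    have "real (support_size (z d)) \<le> K * (\<Sum>s\<in>S. real (card ((\<lambda>x. x + s) ` ?F - ?F)))"
      unfolding support_size_def by (rule SK) simp
    also have "\<dots> \<le> K * (\<Sum>s\<in>S. A s * ?v (bd (Suc m) d))"
    proof (intro mult_left_mono sum_mono S(2))
      fix s
      have "card ((\<lambda>x. x + s) ` ?F - ?F)
          \<le> support_size (z d * Poly_Mapping.single s 1 - z d * Poly_Mapping.single 0 (a s))"
        unfolding support_size_def by (rule card_mono[OF finite_keys translate_support_diff])
      also note A(2)[OF d]
      finally show "real (card ((\<lambda>x. x + s) ` ?F - ?F)) \<le> A s * ?v (bd (Suc m) d)"
        by simp
    qed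
    finally show ?thesis
      by (simp only: sum_distrib_right[symmetric] mult.assoc)
  qed

  \<comment> \<open>\<open>q t\<close> is coordinate \<open>t\<close> of \<open>?p\<close>, a
    cocycle because \<open>?p\<close> kills the boundaries in degree \<open>m + 1\<close>.\<close>
  define q where "q = (\<lambda>t. pullback C (Suc m) ?p (\<lambda>x. Poly_Mapping.lookup x t))"
  have "q t \<in> cocycles C bd (Suc m)" for t
  proof -
    have "module_hom_on scale (*) (C (Suc m)) UNIV (\<lambda>x. Poly_Mapping.lookup x t)"
      by (simp add: module_hom_on_def lookup_add lookup_scale)
    then have "pullback C (Suc m) ?p (\<lambda>x. Poly_Mapping.lookup x t) \<in> cochains C (Suc m)"
      by (rule pullback_cochain[where C = C and k = "Suc m", OF D(2) p])
    then show ?thesis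
      using bdr by (simp add: q_def cocycles_def pullback_def)
  qed
  from coordinate[OF this] obtain a' A' where
    "\<And>t. P (q t) (a' t) (A' t)"
    by metis
  then have A': "A' t \<ge> (0::real)"
    "d \<in> C (Suc m) \<Longrightarrow> real (support_size
      (q t d - z d * Poly_Mapping.single 0 (a' t)))
        \<le> A' t * ?v (bd (Suc m) d)" for t d
    by (simp_all add: P_def)
  \<comment> \<open>Each coordinate contributes its own error \<open>A' t\<close> and the bound on
    \<open>z d\<close>, which also bounds every scalar multiple of \<open>z d\<close>.\<close>
  let ?\<kappa> = "\<Sum>t\<in>T'. K * (\<Sum>s\<in>S. A s) + A' t"
  have p_bound: "real (vector_size (basis_vector ` T') (?p d)) \<le> ?\<kappa> * ?v (bd (Suc m) d)"
    if d: "d \<in> C (Suc m)" for d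
  proof -
    have pd: "?p d \<in> free_on T'"
      using module_hom_onD(1)[OF p d] T'(2) by simp
    have "real (support_size (Poly_Mapping.lookup (?p d) t)) \<le> (K * (\<Sum>s\<in>S. A s) + A' t) * ?v (bd (Suc m) d)" for t
    proof -
      let ?l = "Poly_Mapping.lookup (?p d) t" and ?za = "z d * Poly_Mapping.single 0 (a' t)"
      have "support_size ?l \<le> support_size (?l - ?za) + support_size ?za"
        using support_size_add[of "?l - ?za" ?za] by simp
      moreover have "support_size ?za \<le> support_size (z d)"
        by (rule support_size_scalar)
      moreover have "real (support_size (?l - ?za)) \<le> A' t * ?v (bd (Suc m) d)"
        using A'(2)[OF d, of t] d by (simp add: q_def pullback_def)
      ultimately have "real (support_size ?l) \<le> A' t * ?v (bd (Suc m) d) + K * (\<Sum>s\<in>S. A s) * ?v (bd (Suc m) d)"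
        using z_bound[OF d] by linarith
      then show ?thesis
        by (simp only: distrib_right add.commute)
    qed
    then have "(\<Sum>t\<in>T'. real (support_size (Poly_Mapping.lookup (?p d) t)))
        \<le> (\<Sum>t\<in>T'. (K * (\<Sum>s\<in>S. A s) + A' t) * ?v (bd (Suc m) d))"
      by (rule sum_mono)
    then show ?thesis
      by (simp only: vector_size_free_on[OF T'(1) pd] of_nat_sum sum_distrib_right)
  qed
  show ?thesis
    unfolding linear_isoperimetric_def
  proof (intro exI conjI ballI)
    show "0 \<le> ?\<kappa>"
      using S(2) A(1) A'(1) by (intro sum_nonneg add_nonneg_nonneg mult_nonneg_nonneg)
    \<comment> \<open>Two fillings of \<open>\<gamma>\<close> differ by a cycle, hence by a
      boundary, and \<open>?p\<close> kills boundaries. So \<open>?p d\<close> depends only on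
      \<open>\<gamma>\<close>, however large the initial \<open>d\<close> is.\<close>
    fix \<gamma> assume "\<gamma> \<in> bd (Suc m) ` C (Suc m)"
    then obtain d where d: "d \<in> C (Suc m)" "\<gamma> = bd (Suc m) d"
      by blast
    have "\<gamma> \<in> free_on T"
      using bdin[OF d(1)] d(2) T(2) by simp
    then have "real (vector_size (basis_vector ` T) \<gamma>) = ?v \<gamma>"
      by (simp only: vector_size_free_on[OF T(1)])
    then have "real (vector_size (basis_vector ` T') (?p d)) \<le> ?\<kappa> * real (vector_size (basis_vector ` T) \<gamma>)"
      using p_bound[OF d(1)] d(2) by (simp only:)
    then show "\<exists>d\<in>C (Suc m). bd (Suc m) d = \<gamma> \<and>
        real (vector_size (basis_vector ` T') d) \<le> ?\<kappa> * real (vector_size (basis_vector ` T) \<gamma>)"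
      using module_hom_onD(1)[OF p d(1)] bdp[OF d(1)] d(2) by blast
  qed
qed

theorem theorem3p3:
  fixes n :: nat
  assumes "n \<ge> 1"
    and "PD_group TYPE('g::group_add) TYPE('r::ring_1) n"
    and "(\<exists>star :: 'r \<Rightarrow> 'r. star_ring star \<and> orientable TYPE('g) star n)
         \<or> (\<forall>a b :: 'r. a * b = b * a)"
    and "\<not> amenable TYPE('g)"
  shows "linear_homological_isoperimetric TYPE('g) TYPE('r) (n - 1)"
proof -
  obtain m where n: "n = Suc m"
    using assms(1) by (cases n) auto
  have PD: "PD_group TYPE('g) TYPE('r) (Suc m)"
    using assms(2) n by simp
  obtain C\<^sub>0 :: "nat \<Rightarrow> ('g, 'r) ambient set" and bd\<^sub>0 \<epsilon>\<^sub>0 N\<^sub>0 where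
    C\<^sub>0: "projective_resolution C\<^sub>0 bd\<^sub>0 \<epsilon>\<^sub>0" and fg: "\<And>j. finitely_generated (C\<^sub>0 j)"
    and len\<^sub>0: "\<And>j. j > N\<^sub>0 \<Longrightarrow> C\<^sub>0 j = {0}"
    using PD unfolding PD_group_def type_FP_def by blast
  have fg\<^sub>0: "fg_projective (C\<^sub>0 j)" for j
    by (rule fg_projectiveI[OF projective_resolutionD(1)[OF C\<^sub>0] fg])
  \<comment> \<open>Degree \<open>m\<close> is made free before degree \<open>m + 1\<close>: each
    replacement alters the degree above but none below.\<close>
  obtain C\<^sub>1 :: "nat \<Rightarrow> ('g, 'r) ambient set" and bd\<^sub>1 \<epsilon>\<^sub>1 T N\<^sub>1 where C\<^sub>1: "projective_resolution C\<^sub>1 bd\<^sub>1 \<epsilon>\<^sub>1"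
    and fg\<^sub>1: "\<And>j. fg_projective (C\<^sub>1 j)" and len\<^sub>1: "\<And>j. j > N\<^sub>1 \<Longrightarrow> C\<^sub>1 j = {0}"
    and T: "finite T" "C\<^sub>1 m = free_on T" and "\<And>j. j < m \<Longrightarrow> C\<^sub>1 j = C\<^sub>0 j"
    by (rule free_replacement[OF C\<^sub>0 fg\<^sub>0, where N = N\<^sub>0 and k = m]) (erule len\<^sub>0, blast)
  obtain C :: "nat \<Rightarrow> ('g, 'r) ambient set" and bd \<epsilon> T' N where C: "projective_resolution C bd \<epsilon>"
    and fg: "\<And>j. fg_projective (C j)" and len: "\<And>j. j > N \<Longrightarrow> C j = {0}"
    and T': "finite T'" "C (Suc m) = free_on T'" and CC\<^sub>1: "\<And>j. j < Suc m \<Longrightarrow> C j = C\<^sub>1 j"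
    by (rule free_replacement[OF C\<^sub>1 fg\<^sub>1, where N = N\<^sub>1 and k = "Suc m"]) (erule len\<^sub>1, blast)
  have Cm: "C m = free_on T"
    using CC\<^sub>1[of m] T(2) by simp
  obtain z where z: "cohomology_generator C bd m z"
    using PD_group_cohomology(1)[OF PD C] by blast
  \<comment> \<open>Splitting the boundaries in degree \<open>n = m + 1\<close> uses the vanishing
    of cohomology in degrees \<open>n + 1\<close> and above; this is the lowest degree that the
    vanishing reaches.\<close>
  have "\<exists>r. module_hom_on scale scale (C (Suc m)) (C (Suc (Suc m))) r \<and>
      (\<forall>x\<in>C (Suc (Suc m)). bd (Suc (Suc m)) (r (bd (Suc (Suc m)) x)) = bd (Suc (Suc m)) x)"
  proof (rule boundary_splitting[OF C fg, where N = N and m = m])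
    show "\<exists>b\<in>cochains C k. \<forall>x\<in>C (Suc k). c x = b (bd (Suc k) x)"
      if "k > m" "c \<in> cocycles C bd (Suc k)" for k c
      by (rule PD_group_cohomology(2)[OF PD C that])
    show "C j = {0}" if "j > N" for j
      using that by (rule len)
    show "Suc m > m"
      by simp
  qed
  then obtain r where r: "module_hom_on scale scale (C (Suc m)) (C (Suc (Suc m))) r"
    "\<And>x. x \<in> C (Suc (Suc m)) \<Longrightarrow> bd (Suc (Suc m)) (r (bd (Suc (Suc m)) x)) = bd (Suc (Suc m)) x"
    by blast
  have "linear_isoperimetric m C bd (basis_vector ` T) (basis_vector ` T')"
    by (rule linear_isoperimetric_if_nonamenable[OF C T(1) Cm T' z r(1) _ assms(4)]) (rule r(2))
  moreover have "admissible_resolution m C bd \<epsilon> (basis_vector ` T) (basis_vector ` T')"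
    using C finite_free_basis_free_on[OF T(1)] finite_free_basis_free_on[OF T'(1)] Cm T'(2)
    by (simp add: admissible_resolution_def)
  ultimately show ?thesis
    unfolding linear_homological_isoperimetric_def n diff_Suc_1 by (intro exI conjI)
qed

end
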